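(* There is a data structure for Dynamic Interval Scheduling (on one machine) that supports any sequence of $n$ insert/delete operations in $O(\sqrt{n}\log n)$ amortized time per update.
   Context: An interval is a pair $(s_i,f_i)$ of reals with $s_i<f_i$; endpoints of all intervals are assumed pairwise distinct. Two intervals are compatible if they are disjoint. Dynamic Interval Scheduling: maintain a set $S$ of intervals under insertions and deletions and after each update report the maximum size of a subset of $S$ consisting of pairwise compatible intervals. *)

theory Defs
  imports Complex_Main "HOL-Library.Landau_Symbols"
begin

section \<open>Dynamic Interval Scheduling\<close>

type_synonym interval = "real \<times> real"

definition is_interval :: "interval \<Rightarrow> bool" where
  "is_interval i \<longleftrightarrow> fst i < snd i"

definition endpoints :: "interval \<Rightarrow> real set" where
  "endpoints i = {fst i, snd i}"

text \<open>As all endpoints are distinct, it is immaterial whether intervals are closed or open.\<close>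

definition compatible :: "interval \<Rightarrow> interval \<Rightarrow> bool" where
  "compatible i j \<longleftrightarrow> {fst i..snd i} \<inter> {fst j..snd j} = {}"

definition max_compatible :: "interval set \<Rightarrow> nat" where
  "max_compatible S = Max (card ` {T. T \<subseteq> S \<and> pairwise compatible T})"

datatype update = Insert interval | Delete interval

fun apply_update :: "update \<Rightarrow> interval set \<Rightarrow> interval set" where
  "apply_update (Insert i) S = insert i S"
| "apply_update (Delete i) S = S - {i}"

fun valid_update :: "interval set \<Rightarrow> update \<Rightarrow> bool" where
  "valid_update S (Insert i) \<longleftrightarrow>
     is_interval i \<and> (\<forall>j\<in>S. endpoints i \<inter> endpoints j = {})"
| "valid_update S (Delete i) \<longleftrightarrow> i \<in> S"

fun valid_updates :: "interval set \<Rightarrow> update list \<Rightarrow> bool" where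
  "valid_updates S [] \<longleftrightarrow> True"
| "valid_updates S (u # us) \<longleftrightarrow> valid_update S u \<and> valid_updates (apply_update u S) us"

fun correct_answers :: "interval set \<Rightarrow> update list \<Rightarrow> nat list" where
  "correct_answers S [] = []"
| "correct_answers S (u # us) =
     max_compatible (apply_update u S) # correct_answers (apply_update u S) us"


section \<open>A word RAM with comparable reals\<close>

text \<open>
  Programs are structured programs over a memory with integer words and reals.
  Integer words are unsigned and consist of \<open>w\<close> bits; an overflowing computation is stuck.
  Reals can only be copied and compared, as usual for comparison-based algorithms.
  Variables are registers. A program mentions only finitely many array names, so its arrays
  amount to interleaved parts of one random access memory.
\<close>

record memory =
  ivar :: "string \<Rightarrow> nat"
  rvar :: "string \<Rightarrow> real"
  iarr :: "string \<Rightarrow> nat \<Rightarrow> nat"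
  rarr :: "string \<Rightarrow> nat \<Rightarrow> real"

definition empty_memory :: memory where
  "empty_memory = \<lparr>ivar = \<lambda>_. 0, rvar = \<lambda>_. 0, iarr = \<lambda>_ _. 0, rarr = \<lambda>_ _. 0\<rparr>"

datatype iexp =
    Num nat
  | IVar string
  | IArr string iexp
  | Add iexp iexp
  | Sub iexp iexp
  | Mul iexp iexp
  | Div iexp iexp

datatype rexp =
    RVar string
  | RArr string iexp

datatype bexp =
    ILess iexp iexp
  | RLess rexp rexp
  | BNot bexp
  | BAnd bexp bexp

datatype com =
    Skip
  | IAssign string iexp
  | RAssign string rexp
  | IStore string iexp iexp
  | RStore string iexp rexp
  | Seq com com
  | Cond bexp com com
  | While bexp com

text \<open>Subtraction is truncated at zero, and division by zero yields zero.\<close>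

fun ival :: "iexp \<Rightarrow> memory \<Rightarrow> nat" where
  "ival (Num k) m = k"
| "ival (IVar x) m = ivar m x"
| "ival (IArr a e) m = iarr m a (ival e m)"
| "ival (Add e1 e2) m = ival e1 m + ival e2 m"
| "ival (Sub e1 e2) m = ival e1 m - ival e2 m"
| "ival (Mul e1 e2) m = ival e1 m * ival e2 m"
| "ival (Div e1 e2) m = ival e1 m div ival e2 m"

fun rval :: "rexp \<Rightarrow> memory \<Rightarrow> real" where
  "rval (RVar x) m = rvar m x"
| "rval (RArr a e) m = rarr m a (ival e m)"

fun bval :: "bexp \<Rightarrow> memory \<Rightarrow> bool" where
  "bval (ILess e1 e2) m \<longleftrightarrow> ival e1 m < ival e2 m"
| "bval (RLess r1 r2) m \<longleftrightarrow> rval r1 m < rval r2 m"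
| "bval (BNot b) m \<longleftrightarrow> \<not> bval b m"
| "bval (BAnd b1 b2) m \<longleftrightarrow> bval b1 m \<and> bval b2 m"

text \<open>All intermediate integer values, in particular all addresses, fit into \<open>w\<close> bits.\<close>

fun ifits :: "nat \<Rightarrow> iexp \<Rightarrow> memory \<Rightarrow> bool" where
  "ifits w (Num k) m \<longleftrightarrow> k < 2 ^ w"
| "ifits w (IVar x) m \<longleftrightarrow> ivar m x < 2 ^ w"
| "ifits w (IArr a e) m \<longleftrightarrow> ifits w e m \<and> ival (IArr a e) m < 2 ^ w"
| "ifits w (Add e1 e2) m \<longleftrightarrow> ifits w e1 m \<and> ifits w e2 m \<and> ival (Add e1 e2) m < 2 ^ w"
| "ifits w (Sub e1 e2) m \<longleftrightarrow> ifits w e1 m \<and> ifits w e2 m"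
| "ifits w (Mul e1 e2) m \<longleftrightarrow> ifits w e1 m \<and> ifits w e2 m \<and> ival (Mul e1 e2) m < 2 ^ w"
| "ifits w (Div e1 e2) m \<longleftrightarrow> ifits w e1 m \<and> ifits w e2 m"

fun rfits :: "nat \<Rightarrow> rexp \<Rightarrow> memory \<Rightarrow> bool" where
  "rfits w (RVar x) m \<longleftrightarrow> True"
| "rfits w (RArr a e) m \<longleftrightarrow> ifits w e m"

fun bfits :: "nat \<Rightarrow> bexp \<Rightarrow> memory \<Rightarrow> bool" where
  "bfits w (ILess e1 e2) m \<longleftrightarrow> ifits w e1 m \<and> ifits w e2 m"
| "bfits w (RLess r1 r2) m \<longleftrightarrow> rfits w r1 m \<and> rfits w r2 m"
| "bfits w (BNot b) m \<longleftrightarrow> bfits w b m"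
| "bfits w (BAnd b1 b2) m \<longleftrightarrow> bfits w b1 m \<and> bfits w b2 m"

text \<open>Every operation, memory access and constant has unit cost.\<close>

fun icost :: "iexp \<Rightarrow> nat" where
  "icost (Num k) = 1"
| "icost (IVar x) = 1"
| "icost (IArr a e) = icost e + 1"
| "icost (Add e1 e2) = icost e1 + icost e2 + 1"
| "icost (Sub e1 e2) = icost e1 + icost e2 + 1"
| "icost (Mul e1 e2) = icost e1 + icost e2 + 1"
| "icost (Div e1 e2) = icost e1 + icost e2 + 1"

fun rcost :: "rexp \<Rightarrow> nat" where
  "rcost (RVar x) = 1"
| "rcost (RArr a e) = icost e + 1"

fun bcost :: "bexp \<Rightarrow> nat" where
  "bcost (ILess e1 e2) = icost e1 + icost e2 + 1"
| "bcost (RLess r1 r2) = rcost r1 + rcost r2 + 1"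
| "bcost (BNot b) = bcost b + 1"
| "bcost (BAnd b1 b2) = bcost b1 + bcost b2 + 1"

text \<open>
  \<open>exec w c m t m'\<close>: on \<open>w\<close>-bit words, started in memory \<open>m\<close>, program \<open>c\<close> terminates
  in memory \<open>m'\<close> after \<open>t\<close> time steps.
\<close>

inductive exec :: "nat \<Rightarrow> com \<Rightarrow> memory \<Rightarrow> nat \<Rightarrow> memory \<Rightarrow> bool" for w where
  Skip: "exec w Skip m 1 m"
| IAssign: "ifits w e m \<Longrightarrow>
    exec w (IAssign x e) m (icost e + 1) (m\<lparr>ivar := (ivar m)(x := ival e m)\<rparr>)"
| RAssign: "rfits w r m \<Longrightarrow>
    exec w (RAssign x r) m (rcost r + 1) (m\<lparr>rvar := (rvar m)(x := rval r m)\<rparr>)"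
| IStore: "ifits w e m \<Longrightarrow> ifits w e' m \<Longrightarrow>
    exec w (IStore a e e') m (icost e + icost e' + 1)
      (m\<lparr>iarr := (iarr m)(a := (iarr m a)(ival e m := ival e' m))\<rparr>)"
| RStore: "ifits w e m \<Longrightarrow> rfits w r m \<Longrightarrow>
    exec w (RStore a e r) m (icost e + rcost r + 1)
      (m\<lparr>rarr := (rarr m)(a := (rarr m a)(ival e m := rval r m))\<rparr>)"
| Seq: "exec w c1 m t1 m1 \<Longrightarrow> exec w c2 m1 t2 m2 \<Longrightarrow> exec w (Seq c1 c2) m (t1 + t2) m2"
| CondTrue: "bfits w b m \<Longrightarrow> bval b m \<Longrightarrow> exec w c1 m t m' \<Longrightarrow>
    exec w (Cond b c1 c2) m (bcost b + t + 1) m'"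
| CondFalse: "bfits w b m \<Longrightarrow> \<not> bval b m \<Longrightarrow> exec w c2 m t m' \<Longrightarrow>
    exec w (Cond b c1 c2) m (bcost b + t + 1) m'"
| WhileFalse: "bfits w b m \<Longrightarrow> \<not> bval b m \<Longrightarrow> exec w (While b c) m (bcost b + 1) m"
| WhileTrue: "bfits w b m \<Longrightarrow> bval b m \<Longrightarrow> exec w c m t1 m1 \<Longrightarrow>
    exec w (While b c) m1 t2 m2 \<Longrightarrow> exec w (While b c) m (bcost b + t1 + t2 + 1) m2"

inductive_cases SkipE: "exec w Skip m t m'"
inductive_cases IAssignE: "exec w (IAssign x e) m t m'"
inductive_cases RAssignE: "exec w (RAssign x r) m t m'"
inductive_cases IStoreE: "exec w (IStore a e e') m t m'"
inductive_cases RStoreE: "exec w (RStore a e r) m t m'"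
inductive_cases SeqE: "exec w (Seq c1 c2) m t m'"
inductive_cases CondE: "exec w (Cond b c1 c2) m t m'"
inductive_cases WhileE: "exec w (While b c) m t m'"

lemma exec_deterministic:
  "exec w c m t m' \<Longrightarrow> exec w c m u m'' \<Longrightarrow> t = u \<and> m' = m''"
proof (induction arbitrary: u m'' rule: exec.induct)
  case (Seq c1 m t1 m1 c2 t2 m2)
  from Seq.prems show ?case by (rule SeqE) (auto dest!: Seq.IH)
next
  case (CondTrue b m c1 t m' c2)
  from CondTrue.prems show ?case by (rule CondE) (auto simp: CondTrue.hyps(2) dest!: CondTrue.IH)
next
  case (CondFalse b m c2 t m' c1)
  from CondFalse.prems show ?case by (rule CondE) (auto simp: CondFalse.hyps(2) dest!: CondFalse.IH)
next
  case (WhileFalse b m c)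
  from WhileFalse.prems show ?case by (rule WhileE) (simp_all add: WhileFalse.hyps)
next
  case (WhileTrue b m c t1 m1 t2 m2)
  from WhileTrue.prems show ?case by (rule WhileE) (auto simp: WhileTrue.hyps(2) dest!: WhileTrue.IH)
qed (erule SkipE IAssignE RAssignE IStoreE RStoreE, simp)+


section \<open>Data structures and amortized update time\<close>

record data_structure =
  init_prog :: com
  insert_prog :: com
  delete_prog :: com

text \<open>
  The endpoints of the interval to insert or delete are passed in the real registers
  \<open>''start''\<close> and \<open>''finish''\<close>; the answer is reported in the integer register \<open>''answer''\<close>.
\<close>

definition pass_interval :: "interval \<Rightarrow> memory \<Rightarrow> memory" where
  "pass_interval i m =
     m\<lparr>rvar := (rvar m)(''start'' := fst i, ''finish'' := snd i)\<rparr>"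

definition reported :: "memory \<Rightarrow> nat" where
  "reported m = ivar m ''answer''"

fun exec_update ::
  "nat \<Rightarrow> data_structure \<Rightarrow> update \<Rightarrow> memory \<Rightarrow> nat \<Rightarrow> memory \<Rightarrow> bool" where
  "exec_update w D (Insert i) m t m' \<longleftrightarrow> exec w (insert_prog D) (pass_interval i m) t m'"
| "exec_update w D (Delete i) m t m' \<longleftrightarrow> exec w (delete_prog D) (pass_interval i m) t m'"

text \<open>
  \<open>exec_updates w D us m as t\<close>: started in memory \<open>m\<close>, the updates \<open>us\<close> are processed one
  after the other, reporting the answers \<open>as\<close>, in total time \<open>t\<close>.
\<close>

inductive exec_updates ::
  "nat \<Rightarrow> data_structure \<Rightarrow> update list \<Rightarrow> memory \<Rightarrow> nat list \<Rightarrow> nat \<Rightarrow> bool" for w D where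
  Nil: "exec_updates w D [] m [] 0"
| Cons: "exec_update w D u m t1 m' \<Longrightarrow> exec_updates w D us m' as t2 \<Longrightarrow>
    exec_updates w D (u # us) m (reported m' # as) (t1 + t2)"

definition run :: "nat \<Rightarrow> data_structure \<Rightarrow> update list \<Rightarrow> nat list \<Rightarrow> nat \<Rightarrow> bool" where
  "run w D us as t \<longleftrightarrow>
     (\<exists>t0 m0 t1. exec w (init_prog D) empty_memory t0 m0 \<and>
        exec_updates w D us m0 as t1 \<and> t = t0 + t1)"

text \<open>
  \<open>D\<close> solves Dynamic Interval Scheduling, and every sequence of \<open>n\<close> updates, started from the
  empty set, takes total time at most \<open>n * \<tau> n\<close> on words of \<open>\<Omega>(log n)\<close> bits.
  The number \<open>n\<close> of updates is not known to \<open>D\<close>.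
\<close>

definition supports_updates_amortized :: "data_structure \<Rightarrow> (nat \<Rightarrow> real) \<Rightarrow> bool" where
  "supports_updates_amortized D \<tau> \<longleftrightarrow>
     (\<exists>K. \<forall>w us. us \<noteq> [] \<longrightarrow> valid_updates {} us \<longrightarrow>
        K * log 2 (real (length us) + 1) \<le> real w \<longrightarrow>
        (\<exists>t. run w D us (correct_answers {} us) t \<and>
             real t \<le> real (length us) * \<tau> (length us)))"

end

theory Submission
  imports Defs "HOL-Library.Discrete_Functions"
begin

text \<open>
  The intervals are kept sorted by start and cut into blocks. A scan by increasing start that
  maintains the maximum number of pairwise compatible intervals and the smallest possible last
  finish computes the answer. Once the scan has selected an interval of a block, its effect on the
  rest of the block no longer depends on the past, so it can be tabulated. The first selection
  within a block occurs at the first start after the current finish or at a fixed position,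
  whichever comes first; a binary search finds it. An update hence rebuilds the table of one block
  and skips through all blocks with one binary search each.

  Phase \<open>J\<close> consists of \<open>J\<close> updates on \<open>J\<close> blocks that hold at most \<open>J\<close> intervals initially and
  thus at most \<open>2 * J\<close> at any time. All blocks are rebuilt in time \<open>O(J\<^sup>2)\<close> between phases. After
  \<open>n\<close> updates, \<open>J\<close> is of order \<open>sqrt n\<close>.
\<close>

section \<open>Timed total correctness\<close>

notation
  IVar ("\<acute>_" [1000] 1000) and
  IArr ("_\<lbrakk>_\<rbrakk>" [1000, 0] 999) and
  RArr ("_\<lbrakk>_\<rbrakk>\<^sub>r" [1000, 0] 999) and
  Add (infixl "\<oplus>" 65) and
  Sub (infixl "\<ominus>" 65) and
  Mul (infixl "\<otimes>" 70) and
  Div (infixl "\<oslash>" 70) and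
  ILess (infix "<\<^sub>i" 50) and
  RLess (infix "<\<^sub>r" 50) and
  BNot ("NOT _" [40] 40) and
  BAnd (infixr "AND" 35) and
  Skip ("SKIP") and
  IAssign (infix "::=" 61) and
  RAssign (infix "::=\<^sub>r" 61) and
  IStore ("_\<lbrakk>_\<rbrakk> ::= _" [1000, 0, 62] 61) and
  RStore ("_\<lbrakk>_\<rbrakk> ::=\<^sub>r _" [1000, 0, 62] 61) and
  Seq (infixr ";;" 60) and
  Cond ("(IF _/ THEN _/ ELSE _)" [0, 0, 61] 61) and
  While ("(WHILE _/ DO _)" [0, 61] 61)

definition exec_within ::
  "nat \<Rightarrow> com \<Rightarrow> memory \<Rightarrow> nat \<Rightarrow> (memory \<Rightarrow> bool) \<Rightarrow> bool" where
  "exec_within w c m T Q \<longleftrightarrow> (\<exists>t m'. exec w c m t m' \<and> t \<le> T \<and> Q m')"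

lemma exec_withinI:
  "exec w c m t m' \<Longrightarrow> t \<le> T \<Longrightarrow> Q m' \<Longrightarrow> exec_within w c m T Q"
  by (auto simp: exec_within_def)

subsection \<open>Frames\<close>

datatype location = IReg string | RReg string | IArray string | RArray string

primrec modified :: "com \<Rightarrow> location set" where
  "modified SKIP = {}"
| "modified (x ::= e) = {IReg x}"
| "modified (x ::=\<^sub>r r) = {RReg x}"
| "modified (a\<lbrakk>e\<rbrakk> ::= e') = {IArray a}"
| "modified (a\<lbrakk>e\<rbrakk> ::=\<^sub>r r) = {RArray a}"
| "modified (c1 ;; c2) = modified c1 \<union> modified c2"
| "modified (IF b THEN c1 ELSE c2) = modified c1 \<union> modified c2"
| "modified (WHILE b DO c) = modified c"

definition agree_outside :: "location set \<Rightarrow> memory \<Rightarrow> memory \<Rightarrow> bool" where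
  "agree_outside L m m' \<longleftrightarrow>
     (\<forall>x. IReg x \<notin> L \<longrightarrow> ivar m' x = ivar m x) \<and>
     (\<forall>x. RReg x \<notin> L \<longrightarrow> rvar m' x = rvar m x) \<and>
     (\<forall>a. IArray a \<notin> L \<longrightarrow> iarr m' a = iarr m a) \<and>
     (\<forall>a. RArray a \<notin> L \<longrightarrow> rarr m' a = rarr m a)"

lemma agree_outsideD:
  assumes "agree_outside L m m'"
  shows "IReg x \<notin> L \<Longrightarrow> ivar m' x = ivar m x"
    and "RReg x \<notin> L \<Longrightarrow> rvar m' x = rvar m x"
    and "IArray x \<notin> L \<Longrightarrow> iarr m' x = iarr m x"
    and "RArray x \<notin> L \<Longrightarrow> rarr m' x = rarr m x"
  using assms by (auto simp: agree_outside_def)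

lemma agree_outside_refl: "agree_outside L m m"
  by (simp add: agree_outside_def)

lemma agree_outside_trans:
  "agree_outside L m m' \<Longrightarrow> agree_outside L m' m'' \<Longrightarrow> agree_outside L m m''"
  by (simp add: agree_outside_def)

lemma exec_agree_outside: "exec w c m t m' \<Longrightarrow> agree_outside (modified c) m m'"
  by (induction rule: exec.induct) (simp_all add: agree_outside_def)

subsection \<open>Rules\<close>

lemma exec_within_weaken:
  assumes "exec_within w c m T Q"
    and "\<And>m'. agree_outside (modified c) m m' \<Longrightarrow> Q m' \<Longrightarrow> Q' m'" and "T \<le> T'"
  shows "exec_within w c m T' Q'"
  using assms exec_agree_outside unfolding exec_within_def by (meson order_trans)

lemma exec_within_Seq:
  assumes "exec_within w c1 m T1 P"
    and "\<And>m1. agree_outside (modified c1) m m1 \<Longrightarrow> P m1 \<Longrightarrow> exec_within w c2 m1 T2 Q"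
    and "T1 + T2 \<le> T"
  shows "exec_within w (c1 ;; c2) m T Q"
proof -
  obtain t1 m1 where c1: "exec w c1 m t1 m1" "t1 \<le> T1" "P m1"
    using assms(1) by (auto simp: exec_within_def)
  obtain t2 m2 where c2: "exec w c2 m1 t2 m2" "t2 \<le> T2" "Q m2"
    using assms(2)[OF exec_agree_outside[OF c1(1)] c1(3)] by (auto simp: exec_within_def)
  have "t1 + t2 \<le> T" using c1(2) c2(2) assms(3) by simp
  then show ?thesis using exec.Seq[OF c1(1) c2(1)] c2(3) by (blast intro: exec_withinI)
qed

lemma exec_within_Cond:
  assumes "bfits w b m"
    and "bval b m \<Longrightarrow> exec_within w c1 m T Q" and "\<not> bval b m \<Longrightarrow> exec_within w c2 m T Q"
    and "bcost b + T + 1 \<le> T'"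
  shows "exec_within w (IF b THEN c1 ELSE c2) m T' Q"
proof (cases "bval b m")
  case True
  then obtain t m' where branch: "exec w c1 m t m'" "t \<le> T" "Q m'"
    using assms(2) by (auto simp: exec_within_def)
  show ?thesis
    by (rule exec_withinI[OF exec.CondTrue[OF assms(1) True branch(1)]])
      (use branch assms(4) in simp_all)
next
  case False
  then obtain t m' where branch: "exec w c2 m t m'" "t \<le> T" "Q m'"
    using assms(3) by (auto simp: exec_within_def)
  show ?thesis
    by (rule exec_withinI[OF exec.CondFalse[OF assms(1) False branch(1)]])
      (use branch assms(4) in simp_all)
qed

primrec wp :: "nat \<Rightarrow> com \<Rightarrow> (memory \<Rightarrow> bool) \<Rightarrow> memory \<Rightarrow> bool" where
  "wp w SKIP Q m \<longleftrightarrow> Q m"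
| "wp w (x ::= e) Q m \<longleftrightarrow> ifits w e m \<and> Q (m\<lparr>ivar := (ivar m)(x := ival e m)\<rparr>)"
| "wp w (x ::=\<^sub>r r) Q m \<longleftrightarrow> rfits w r m \<and> Q (m\<lparr>rvar := (rvar m)(x := rval r m)\<rparr>)"
| "wp w (a\<lbrakk>e\<rbrakk> ::= e') Q m \<longleftrightarrow> ifits w e m \<and> ifits w e' m \<and>
     Q (m\<lparr>iarr := (iarr m)(a := (iarr m a)(ival e m := ival e' m))\<rparr>)"
| "wp w (a\<lbrakk>e\<rbrakk> ::=\<^sub>r r) Q m \<longleftrightarrow> ifits w e m \<and> rfits w r m \<and>
     Q (m\<lparr>rarr := (rarr m)(a := (rarr m a)(ival e m := rval r m))\<rparr>)"
| "wp w (c1 ;; c2) Q m \<longleftrightarrow> wp w c1 (wp w c2 Q) m"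
| "wp w (IF b THEN c1 ELSE c2) Q m \<longleftrightarrow>
     bfits w b m \<and> (if bval b m then wp w c1 Q m else wp w c2 Q m)"
| "wp w (WHILE b DO c) Q m \<longleftrightarrow> False" \<comment> \<open>not exact: \<open>wp\<close> serves loop-free programs only\<close>

lemma wp_mono: "wp w c Q m \<Longrightarrow> (\<And>m'. Q m' \<Longrightarrow> Q' m') \<Longrightarrow> wp w c Q' m"
proof (induction c arbitrary: Q Q' m)
  case (Seq c1 c2)
  show ?case using Seq.prems(1) Seq.IH(2)[OF _ Seq.prems(2)]
    by (simp) (rule Seq.IH(1))
next
  case (Cond b c1 c2)
  then show ?case by (metis wp.simps(7))
qed auto

primrec cost :: "com \<Rightarrow> nat" where
  "cost SKIP = 1"
| "cost (x ::= e) = icost e + 1"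
| "cost (x ::=\<^sub>r r) = rcost r + 1"
| "cost (a\<lbrakk>e\<rbrakk> ::= e') = icost e + icost e' + 1"
| "cost (a\<lbrakk>e\<rbrakk> ::=\<^sub>r r) = icost e + rcost r + 1"
| "cost (c1 ;; c2) = cost c1 + cost c2"
| "cost (IF b THEN c1 ELSE c2) = bcost b + max (cost c1) (cost c2) + 1"
| "cost (WHILE b DO c) = 0"

lemma exec_within_cost: "wp w c Q m \<Longrightarrow> exec_within w c m (cost c) Q"
proof (induction c arbitrary: Q m)
  case (Seq c1 c2)
  from Seq.prems have "exec_within w c1 m (cost c1) (wp w c2 Q)" by (intro Seq.IH(1)) simp
  then show ?case by (rule exec_within_Seq[where ?T2.0 = "cost c2"]) (simp_all add: Seq.IH(2))
next
  case (Cond b c1 c2)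
  show ?case
  proof (rule exec_within_Cond)
    show "exec_within w c1 m (max (cost c1) (cost c2)) Q" if "bval b m"
      using that Cond by (auto intro: exec_within_weaken[OF Cond.IH(1)])
    show "exec_within w c2 m (max (cost c1) (cost c2)) Q" if "\<not> bval b m"
      using that Cond by (auto intro: exec_within_weaken[OF Cond.IH(2)])
  qed (use Cond.prems in auto)
qed (auto intro!: exec_withinI exec.Skip exec.IAssign exec.RAssign exec.IStore exec.RStore
    simp del: One_nat_def)

lemma exec_within_wp: "wp w c Q m \<Longrightarrow> cost c \<le> T \<Longrightarrow> exec_within w c m T Q"
  by (blast intro: exec_within_weaken exec_within_cost)

lemma exec_within_Seq_wp:
  assumes "wp w c1 (\<lambda>m1. exec_within w c2 m1 T2 Q) m" and "cost c1 + T2 \<le> T"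
  shows "exec_within w (c1 ;; c2) m T Q"
  using exec_within_Seq[OF exec_within_cost[OF assms(1)] _ assms(2)] .

lemma exec_within_init:
  assumes "exec_within w c (m\<lparr>ivar := (ivar m)(x := k)\<rparr>) T Q" "k < 2 ^ w" "T + 2 \<le> T'"
  shows "exec_within w (x ::= Num k ;; c) m T' Q"
  using assms by (intro exec_within_Seq_wp[where ?T2.0 = T]) simp_all

text \<open>The index of the invariant bounds the number of remaining iterations.\<close>

lemma exec_within_While:
  assumes "I r m0"
    and fits: "\<And>r m. I r m \<Longrightarrow> agree_outside (modified c) m0 m \<Longrightarrow> bfits w b m"
    and body: "\<And>r m. I r m \<Longrightarrow> agree_outside (modified c) m0 m \<Longrightarrow> bval b m \<Longrightarrow>
      exec_within w c m C (\<lambda>m'. \<exists>r'<r. I r' m')"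
    and exit: "\<And>r m. I r m \<Longrightarrow> agree_outside (modified c) m0 m \<Longrightarrow> \<not> bval b m \<Longrightarrow> Q m"
    and "r * (C + bcost b + 1) + bcost b + 1 \<le> T"
  shows "exec_within w (WHILE b DO c) m0 T Q"
proof -
  let ?T = "\<lambda>r. r * (C + bcost b + 1) + bcost b + 1"
  have "exec_within w (WHILE b DO c) m (?T r) Q" if "I r m" "agree_outside (modified c) m0 m" for m
    using that
  proof (induction r arbitrary: m rule: less_induct)
    case (less r)
    show ?case
    proof (cases "bval b m")
      case False
      have "exec w (WHILE b DO c) m (bcost b + 1) m"
        using exec.WhileFalse[OF fits[OF less.prems] False] .
      then show ?thesis by (rule exec_withinI) (use exit[OF less.prems False] in simp_all)
    next
      case True
      obtain t1 m1 r' where c: "exec w c m t1 m1" "t1 \<le> C" and r': "r' < r" "I r' m1"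
        using body[OF less.prems True] by (auto simp: exec_within_def)
      have "agree_outside (modified c) m0 m1"
        using agree_outside_trans[OF less.prems(2) exec_agree_outside[OF c(1)]] .
      then obtain t2 m2 where loop: "exec w (WHILE b DO c) m1 t2 m2" "t2 \<le> ?T r'" "Q m2"
        using less.IH[OF r'] by (auto simp: exec_within_def)
      have "Suc r' * (C + bcost b + 1) \<le> r * (C + bcost b + 1)"
        using r'(1) by (intro mult_le_mono1) simp
      then have "bcost b + t1 + t2 + 1 \<le> ?T r" using c(2) loop(2) by simp
      then show ?thesis
        using exec.WhileTrue[OF fits[OF less.prems] True c(1) loop(1)] loop(3)
        by (blast intro: exec_withinI)
    qed
  qed
  from this[OF assms(1) agree_outside_refl] show ?thesis
    by (rule exec_within_weaken) (use assms(5) in auto)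
qed

definition For :: "string \<Rightarrow> string \<Rightarrow> com \<Rightarrow> com" ("(FOR _ < _/ DO _)" [1000, 1000, 61] 61) where
  "(FOR x < y DO c) = x ::= Num 0 ;; WHILE \<acute>x <\<^sub>i \<acute>y DO (c ;; x ::= \<acute>x \<oplus> Num 1)"

lemma modified_For [simp]: "modified (FOR x < y DO c) = insert (IReg x) (modified c)"
  by (auto simp: For_def)

lemma exec_within_For:
  assumes y: "ivar m0 y = n" "n < 2 ^ w" and xy: "x \<noteq> y"
    and unmodified: "IReg x \<notin> modified c" "IReg y \<notin> modified c"
    and init: "I 0 (m0\<lparr>ivar := (ivar m0)(x := 0)\<rparr>)"
    and step: "\<And>k m. k < n \<Longrightarrow> I k m \<Longrightarrow> ivar m x = k \<Longrightarrow>
      agree_outside (insert (IReg x) (modified c)) m0 m \<Longrightarrow>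
      exec_within w c m C (\<lambda>m'. I (Suc k) (m'\<lparr>ivar := (ivar m')(x := Suc k)\<rparr>))"
    and exit: "\<And>m. I n m \<Longrightarrow> agree_outside (insert (IReg x) (modified c)) m0 m \<Longrightarrow> Q m"
    and time: "n * (C + 8) + 6 \<le> T"
  shows "exec_within w (FOR x < y DO c) m0 T Q"
  unfolding For_def
proof (rule exec_within_init[where T = "n * (C + 8) + 4"],
    rule exec_within_While[where r = n and C = "C + 4" and
      I = "\<lambda>r m. ivar m x + r = n \<and> I (ivar m x) m"])
  let ?body = "c ;; x ::= \<acute>x \<oplus> Num 1" and ?m = "m0\<lparr>ivar := (ivar m0)(x := 0)\<rparr>"
  fix r m
  assume inv: "ivar m x + r = n \<and> I (ivar m x) m" and "agree_outside (modified ?body) ?m m"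
  then have agree: "agree_outside (insert (IReg x) (modified c)) m0 m"
    by (auto simp: agree_outside_def)
  have m_y: "ivar m y = n" using agree y xy unmodified by (simp add: agree_outsideD)
  show "bfits w (\<acute>x <\<^sub>i \<acute>y) m" using inv m_y y by simp
  show "Q m" if "\<not> bval (\<acute>x <\<^sub>i \<acute>y) m"
    using that inv m_y exit[OF _ agree] by (cases "ivar m x = n") simp_all
  assume "bval (\<acute>x <\<^sub>i \<acute>y) m"
  then have less: "ivar m x < n" using m_y by simp
  have "exec_within w c m C
    (\<lambda>m'. I (Suc (ivar m x)) (m'\<lparr>ivar := (ivar m')(x := Suc (ivar m x))\<rparr>))"
    using step[OF less] inv agree by simp
  then show "exec_within w ?body m (C + 4) (\<lambda>m'. \<exists>r'<r. ivar m' x + r' = n \<and> I (ivar m' x) m')"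
  proof (rule exec_within_Seq)
    fix m1
    assume "agree_outside (modified c) m m1"
      and "I (Suc (ivar m x)) (m1\<lparr>ivar := (ivar m1)(x := Suc (ivar m x))\<rparr>)"
    moreover from this have "ivar m1 x = ivar m x" using unmodified by (simp add: agree_outsideD)
    ultimately show "exec_within w (x ::= \<acute>x \<oplus> Num 1) m1 4
        (\<lambda>m'. \<exists>r'<r. ivar m' x + r' = n \<and> I (ivar m' x) m')"
      using inv less y(2) by (intro exec_within_wp) (auto intro!: exI[of _ "r - 1"])
  qed simp
qed (use init time in simp_all)

section \<open>The greedy scan\<close>

text \<open>The first component counts the selected intervals, the second one is the smallest possible
  last finish of that many pairwise compatible intervals; it is meaningless while the count is
  zero.\<close>

fun step :: "interval \<Rightarrow> nat \<times> real \<Rightarrow> nat \<times> real" where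
  "step (s, f) (c, x) = (if c = 0 \<or> x < s then (Suc c, f) else (c, min x f))"

abbreviation start_sorted :: "interval list \<Rightarrow> bool" where
  "start_sorted \<equiv> sorted_wrt (\<lambda>i j. fst i < fst j)"

lemma fst_fold_step_le: "fst (fold step xs st) \<le> fst st + length xs"
proof (induction xs arbitrary: st)
  case (Cons i xs)
  have "fst (step i st) \<le> Suc (fst st)" by (cases i; cases st) auto
  then show ?case using Cons[of "step i st"] by simp
qed simp

lemma fold_step_add:
  assumes "0 < c"
  shows "fold step xs (c + d, x) = apfst (\<lambda>n. n + d) (fold step xs (c, x))"
  using assms
proof (induction xs arbitrary: c x)
  case (Cons i xs)
  obtain s f where "i = (s, f)" by force
  then show ?case using Cons.prems Cons.IH[of "Suc c" f] Cons.IH[of c "min x f"] by simp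
qed simp

subsection \<open>Optimality\<close>

definition schedules :: "interval set \<Rightarrow> interval set set" where
  "schedules P = {T. T \<subseteq> P \<and> pairwise compatible T}"

lemma finite_schedule: "T \<in> schedules P \<Longrightarrow> finite P \<Longrightarrow> finite T"
  unfolding schedules_def by (blast intro: finite_subset)

definition scan_optimal :: "interval set \<Rightarrow> nat \<times> real \<Rightarrow> bool" where
  "scan_optimal P st \<longleftrightarrow> (case st of (c, x) \<Rightarrow>
     (\<exists>T\<in>schedules P. card T = c \<and> (\<forall>j\<in>T. snd j \<le> x)) \<and>
     (\<forall>T\<in>schedules P. card T \<le> c) \<and>
     (\<forall>T\<in>schedules P. 0 < c \<longrightarrow> (\<forall>j\<in>T. snd j < x) \<longrightarrow> card T < c))"

lemma compatible_iff:
  assumes "is_interval i" "is_interval j"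
  shows "compatible i j \<longleftrightarrow> snd i < fst j \<or> snd j < fst i"
  using assms by (auto simp: compatible_def is_interval_def)

context
  fixes P :: "interval set" and i :: interval
  assumes fin: "finite P" and intervals: "\<forall>j\<in>insert i P. is_interval j"
    and last: "\<forall>j\<in>P. fst j < fst i"
begin

lemma compatible_last_iff: "j \<in> P \<Longrightarrow> compatible i j \<longleftrightarrow> snd j < fst i"
  "j \<in> P \<Longrightarrow> compatible j i \<longleftrightarrow> snd j < fst i"
  using intervals last by (fastforce simp: compatible_iff is_interval_def)+

lemma insert_last_schedule:
  assumes "T \<in> schedules P" "\<forall>j\<in>T. snd j < fst i"
  shows "insert i T \<in> schedules (insert i P)" "card (insert i T) = Suc (card T)"
proof -
  have "i \<notin> T" using assms last by (auto simp: schedules_def)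
  moreover have "finite T" using finite_schedule[OF assms(1) fin] .
  ultimately show "card (insert i T) = Suc (card T)" by simp
  have "compatible i j" "compatible j i" if "j \<in> T" for j
    using that assms compatible_last_iff[of j] by (auto simp: schedules_def)
  then show "insert i T \<in> schedules (insert i P)"
    using assms(1) by (simp add: schedules_def pairwise_insert subset_insertI2)
qed

lemma remove_last_schedule:
  assumes "T \<in> schedules (insert i P)" "i \<in> T"
  shows "T - {i} \<in> schedules P" "\<forall>j\<in>T - {i}. snd j < fst i" "card T = Suc (card (T - {i}))"
proof -
  have "finite T" using finite_schedule[OF assms(1)] fin by simp
  then show "card T = Suc (card (T - {i}))" using assms(2) by (rule card.remove)
  show T: "T - {i} \<in> schedules P" using assms by (auto simp: schedules_def pairwise_def)
  show "\<forall>j\<in>T - {i}. snd j < fst i"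
  proof
    fix j assume "j \<in> T - {i}"
    moreover from this have "compatible i j" using assms by (auto simp: schedules_def pairwise_def)
    ultimately show "snd j < fst i" using T compatible_last_iff(1)[of j]
      by (auto simp: schedules_def)
  qed
qed

lemma schedules_insert_last_cases:
  assumes "T \<in> schedules (insert i P)"
  obtains (without_last) "T \<in> schedules P" | (with_last) "i \<in> T"
  using assms by (auto simp: schedules_def)

lemma card_finishing_before_last:
  assumes "T \<in> schedules P"
  shows "card T \<le> Suc (card {j \<in> T. snd j < fst i})"
proof -
  have "finite T" using finite_schedule[OF assms(1)] fin by simp
  have "j = l" if "j \<in> T" "l \<in> T" "\<not> snd j < fst i" "\<not> snd l < fst i" for j l
  proof (rule ccontr)
    assume "j \<noteq> l"
    then have "compatible j l" using that assms by (auto simp: schedules_def pairwise_def)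
    moreover have P: "j \<in> P" "l \<in> P" using that assms by (auto simp: schedules_def)
    ultimately have "snd j < fst l \<or> snd l < fst j" using intervals by (simp add: compatible_iff)
    moreover have "fst l < fst i" "fst j < fst i" using P last by auto
    ultimately show False using that by linarith
  qed
  then have "card {j \<in> T. \<not> snd j < fst i} \<le> 1"
    using \<open>finite T\<close> by (simp add: card_le_Suc0_iff_eq)
  moreover have "card T = card {j \<in> T. snd j < fst i} + card {j \<in> T. \<not> snd j < fst i}"
    using \<open>finite T\<close> by (subst card_Un_disjoint[symmetric]) (auto intro: arg_cong[where f = card])
  ultimately show ?thesis by simp
qed

lemma scan_optimal_select:
  assumes opt: "scan_optimal P (c, x)" and select: "c = 0 \<or> x < fst i"
  shows "scan_optimal (insert i P) (Suc c, snd i)"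
proof -
  obtain T where T: "T \<in> schedules P" "card T = c" "\<forall>j\<in>T. snd j \<le> x"
    using opt by (auto simp: scan_optimal_def)
  have le: "card U \<le> c" if "U \<in> schedules P" for U using opt that by (auto simp: scan_optimal_def)
  have "finite T" using finite_schedule[OF T(1) fin] .
  then have before: "\<forall>j\<in>T. snd j < fst i" using T select by (cases "c = 0") fastforce+
  have "\<forall>j\<in>insert i T. snd j \<le> snd i" using before intervals by (fastforce simp: is_interval_def)
  then have "\<exists>U\<in>schedules (insert i P). card U = Suc c \<and> (\<forall>j\<in>U. snd j \<le> snd i)"
    using insert_last_schedule[OF T(1) before] T(2) by metis
  moreover have "card U \<le> Suc c \<and> ((\<forall>j\<in>U. snd j < snd i) \<longrightarrow> card U < Suc c)"
    if U: "U \<in> schedules (insert i P)" for U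
    using U
  proof (cases rule: schedules_insert_last_cases)
    case without_last
    then show ?thesis using le[of U] by simp
  next
    case with_last
    note removed = remove_last_schedule[OF U with_last]
    have "card U \<le> Suc c" using removed(3) le[OF removed(1)] by linarith
    then show ?thesis using with_last by auto
  qed
  ultimately show ?thesis by (simp add: scan_optimal_def)
qed

lemma scan_optimal_exchange:
  assumes opt: "scan_optimal P (c, x)" and skip: "0 < c" "fst i \<le> x"
  shows "\<exists>U\<in>schedules (insert i P). card U = c \<and> (\<forall>j\<in>U. snd j \<le> snd i)"
proof -
  obtain T where T: "T \<in> schedules P" "card T = c" using opt by (auto simp: scan_optimal_def)
  let ?U = "{j \<in> T. snd j < fst i}"
  have U: "?U \<in> schedules P" using T(1) by (auto simp: schedules_def pairwise_def)
  then have "card ?U < c" using opt skip by (fastforce simp: scan_optimal_def)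
  then have "card ?U = c - 1" using card_finishing_before_last[OF T(1)] T(2) by simp
  moreover have "\<forall>j\<in>insert i ?U. snd j \<le> snd i" using intervals by (fastforce simp: is_interval_def)
  ultimately show ?thesis
    using insert_last_schedule[OF U] skip(1) by (intro bexI[of _ "insert i ?U"]) auto
qed

lemma scan_optimal_skip:
  assumes opt: "scan_optimal P (c, x)" and skip: "0 < c" "fst i \<le> x"
  shows "scan_optimal (insert i P) (c, min x (snd i))"
proof -
  have "\<exists>U\<in>schedules (insert i P). card U = c \<and> (\<forall>j\<in>U. snd j \<le> min x (snd i))"
  proof (cases "x \<le> snd i")
    case True
    obtain T where "T \<in> schedules P" "card T = c" "\<forall>j\<in>T. snd j \<le> x"
      using opt by (auto simp: scan_optimal_def)
    then show ?thesis using True by (intro bexI[of _ T]) (auto simp: schedules_def)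
  next
    case False
    then show ?thesis using scan_optimal_exchange[OF assms] by (simp add: min_def)
  qed
  moreover have "card U \<le> c \<and> ((\<forall>j\<in>U. snd j < min x (snd i)) \<longrightarrow> card U < c)"
    if U: "U \<in> schedules (insert i P)" for U
    using U
  proof (cases rule: schedules_insert_last_cases)
    case without_last
    then show ?thesis using opt skip by (auto simp: scan_optimal_def)
  next
    case with_last
    note removed = remove_last_schedule[OF U with_last]
    have "\<forall>j\<in>U - {i}. snd j < x" using removed(2) skip(2) by (metis less_le_trans)
    then have "card (U - {i}) < c" using opt skip(1) removed(1) by (auto simp: scan_optimal_def)
    then have "card U \<le> c" using removed(3) by linarith
    moreover have "\<not> (\<forall>j\<in>U. snd j < min x (snd i))" using with_last by auto
    ultimately show ?thesis by blast
  qed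
  ultimately show ?thesis by (simp add: scan_optimal_def)
qed

end

lemma scan_optimal_fold:
  assumes "start_sorted xs" "\<forall>i\<in>set xs. is_interval i"
  shows "scan_optimal (set xs) (fold step xs (0, x))"
  using assms
proof (induction xs rule: rev_induct)
  case Nil
  show ?case by (auto simp: scan_optimal_def schedules_def)
next
  case (snoc i xs)
  obtain c y where st: "fold step xs (0, x) = (c, y)" by force
  have opt: "scan_optimal (set xs) (c, y)" using snoc by (simp add: sorted_wrt_append flip: st)
  have "scan_optimal (insert i (set xs)) (step i (c, y))"
  proof (cases "c = 0 \<or> y < fst i")
    case True
    then show ?thesis using scan_optimal_select[OF _ _ _ opt] snoc.prems
      by (cases i) (auto simp: sorted_wrt_append)
  next
    case False
    then show ?thesis using scan_optimal_skip[OF _ _ _ opt] snoc.prems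
      by (cases i) (auto simp: sorted_wrt_append)
  qed
  then show ?case by (simp add: st)
qed

lemma fold_step_max_compatible:
  assumes "start_sorted xs" "\<forall>i\<in>set xs. is_interval i"
  shows "fst (fold step xs (0, x)) = max_compatible (set xs)"
proof -
  have "finite (schedules (set xs))" by (simp add: schedules_def)
  then have "Max (card ` schedules (set xs)) = fst (fold step xs (0, x))"
    using scan_optimal_fold[OF assms, of x]
    by (intro Max_eqI) (auto simp: scan_optimal_def image_iff)
  then show ?thesis by (simp add: max_compatible_def schedules_def)
qed

section \<open>Skipping a block of the scan\<close>

text \<open>For start-sorted intervals this says that they pairwise intersect.\<close>

definition overlapping :: "interval list \<Rightarrow> bool" where
  "overlapping = sorted_wrt (\<lambda>i j. fst j \<le> snd i)"

lemma overlapping_drop: "overlapping xs \<Longrightarrow> overlapping (drop n xs)"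
  by (simp add: overlapping_def sorted_wrt_drop)

lemma fold_step_overlapping:
  assumes "overlapping xs" "0 < c" "\<forall>i\<in>set xs. fst i \<le> x"
  shows "fold step xs (c, x) = (c, Min (insert x (snd ` set xs)))"
  using assms
proof (induction xs arbitrary: x)
  case (Cons i xs)
  have "fold step (i # xs) (c, x) = fold step xs (c, min x (snd i))"
    using Cons.prems by (cases i) auto
  also have "\<dots> = (c, Min (insert (min x (snd i)) (snd ` set xs)))"
    using Cons.prems by (intro Cons.IH) (auto simp: overlapping_def)
  also have "Min (insert (min x (snd i)) (snd ` set xs)) = Min (insert x (snd ` set (i # xs)))"
    by (cases "xs = []") (simp_all add: min.assoc)
  finally show ?case .
qed simp

lemma fold_step_conflict:
  assumes "overlapping ys" "0 < c" "\<forall>j\<in>set ys. fst j \<le> x"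
    and conflict: "x < fst i \<or> (\<exists>j\<in>set ys. snd j < fst i)"
  shows "fold step (ys @ i # zs) (c, x) = fold step zs (Suc c, snd i)"
proof -
  have "Min (insert x (snd ` set ys)) < fst i" using conflict by (auto simp: Min_less_iff)
  then show ?thesis using fold_step_overlapping[OF assms(1-3)] by (cases i) simp
qed

text \<open>The state after a scan that selects the interval at position \<open>p\<close> first.\<close>

definition scan_from :: "interval list \<Rightarrow> nat \<Rightarrow> nat \<times> real" where
  "scan_from xs p = fold step (drop (Suc p) xs) (1, snd (xs ! p))"

lemma fold_step_selected:
  "fold step (drop (Suc p) xs) (Suc c, snd (xs ! p)) = apfst (\<lambda>n. n + c) (scan_from xs p)"
  using fold_step_add[of 1 "drop (Suc p) xs" c "snd (xs ! p)"] by (simp add: scan_from_def)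

lemma fst_scan_from_le:
  assumes "p < length xs"
  shows "fst (scan_from xs p) \<le> length xs"
  using fst_fold_step_le[of "drop (Suc p) xs" "(1, snd (xs ! p))"] assms
  by (simp add: scan_from_def)

lemma drop_eq_window:
  assumes "p \<le> q" "q < length xs"
  shows "drop p xs = drop p (take q xs) @ xs ! q # drop (Suc q) xs"
proof -
  have "drop p xs = drop p (take q xs @ drop q xs)" by simp
  also have "\<dots> = drop p (take q xs) @ drop q xs"
    using assms by (simp only: drop_append length_take) simp
  finally show ?thesis using assms by (simp add: Cons_nth_drop_Suc)
qed

lemma window_Cons:
  assumes "p < q" "q \<le> length xs"
  shows "drop p (take q xs) = xs ! p # drop (Suc p) (take q xs)"
  using assms by (simp flip: Cons_nth_drop_Suc)

lemma scan_from_conflict: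
  assumes "p < q" "q < length xs" and overlap: "overlapping (drop p (take q xs))"
    and conflict: "\<exists>i\<in>set (drop p (take q xs)). snd i < fst (xs ! q)"
  shows "scan_from xs p = apfst Suc (scan_from xs q)"
proof -
  have window: "drop p (take q xs) = xs ! p # drop (Suc p) (take q xs)"
    using assms by (intro window_Cons) auto
  have "drop (Suc p) xs = drop (Suc p) (take q xs) @ xs ! q # drop (Suc q) xs"
    using assms by (intro drop_eq_window) auto
  then have "scan_from xs p = fold step (drop (Suc q) xs) (Suc 1, snd (xs ! q))"
    unfolding scan_from_def using overlap conflict window
    by (simp only:, intro fold_step_conflict) (auto simp: overlapping_def)
  then show ?thesis using fold_step_selected[of q xs 1] by simp
qed

lemma scan_from_overlapping:
  assumes "p < length xs" "overlapping (drop p xs)"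
  shows "scan_from xs p = (1, Min (snd ` set (drop p xs)))"
proof -
  have "drop p xs = xs ! p # drop (Suc p) xs" using assms(1) by (simp add: Cons_nth_drop_Suc)
  then show ?thesis using assms(2) fold_step_overlapping[of "drop (Suc p) xs" 1 "snd (xs ! p)"]
    by (simp add: scan_from_def overlapping_def)
qed

lemma scan_from_overlapping_Suc:
  assumes "p < length xs" "overlapping (drop p xs)"
  shows "scan_from xs p = (1, if Suc p < length xs \<and> snd (scan_from xs (Suc p)) < snd (xs ! p)
    then snd (scan_from xs (Suc p)) else snd (xs ! p))"
proof (cases "Suc p < length xs")
  case True
  have "overlapping (drop (Suc p) xs)" using overlapping_drop[OF assms(2), of 1] by simp
  then have "scan_from xs (Suc p) = (1, Min (snd ` set (drop (Suc p) xs)))"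
    using True scan_from_overlapping by blast
  moreover have "set (drop p xs) = insert (xs ! p) (set (drop (Suc p) xs))"
    using assms(1) by (simp flip: Cons_nth_drop_Suc)
  ultimately have "scan_from xs p = (1, min (snd (xs ! p)) (snd (scan_from xs (Suc p))))"
    using scan_from_overlapping[OF assms] True by simp
  then show ?thesis using True by (auto simp: min_def)
qed (simp add: scan_from_def)

text \<open>\<open>N\<close> is the length of the longest overlapping prefix: the interval at position \<open>N\<close> is selected
  whatever the state before the block is, provided that something has been selected at all.\<close>

definition skip_table :: "interval list \<Rightarrow> nat \<Rightarrow> (nat \<Rightarrow> nat) \<Rightarrow> (nat \<Rightarrow> real) \<Rightarrow> bool" where
  "skip_table xs N A Y \<longleftrightarrow> N \<le> length xs \<and> overlapping (take N xs) \<and>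
     (N < length xs \<longrightarrow> (\<exists>i\<in>set (take N xs). snd i < fst (xs ! N))) \<and>
     (\<forall>p<length xs. (A p, Y p) = scan_from xs p)"

lemma skip_table_cong:
  assumes "\<And>p. p < length xs \<Longrightarrow> A p = A' p \<and> Y p = Y' p"
  shows "skip_table xs N A Y \<longleftrightarrow> skip_table xs N A' Y'"
  using assms by (auto simp: skip_table_def)

lemma fold_step_select:
  assumes table: "skip_table xs N A Y" and p: "p \<le> (if c = 0 then 0 else N)" "p < length xs"
    and before: "\<And>j. j < p \<Longrightarrow> fst (xs ! j) \<le> x"
    and at: "p < (if c = 0 then 0 else N) \<Longrightarrow> x < fst (xs ! p)"
  shows "fold step xs (c, x) = (c + A p, Y p)"
proof -
  have AY: "scan_from xs p = (A p, Y p)" using table p(2) by (simp add: skip_table_def)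
  have xs: "xs = take p xs @ xs ! p # drop (Suc p) xs" using p(2) by (rule id_take_nth_drop)
  have "fold step xs (c, x) = fold step (drop (Suc p) xs) (Suc c, snd (xs ! p))"
  proof (cases "c = 0")
    case True
    then show ?thesis using xs p by (cases xs) auto
  next
    case False
    have "overlapping (take N xs)" using table by (simp add: skip_table_def)
    then have "overlapping (take p (take N xs))" by (simp only: overlapping_def sorted_wrt_take)
    then have "overlapping (take p xs)" using p False by (simp add: min_def)
    moreover have "\<forall>j\<in>set (take p xs). fst j \<le> x" using before by (simp add: all_set_conv_all_nth)
    moreover have "x < fst (xs ! p) \<or> (\<exists>j\<in>set (take p xs). snd j < fst (xs ! p))"
      using table p at False by (cases "p < N") (auto simp: skip_table_def)
    ultimately show ?thesis using False by (subst xs) (intro fold_step_conflict, auto)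
  qed
  then show ?thesis using AY by (simp add: fold_step_selected)
qed

lemma fold_step_keep:
  assumes table: "skip_table xs (length xs) A Y" and "0 < c" "xs \<noteq> []" "\<forall>i\<in>set xs. fst i \<le> x"
  shows "fold step xs (c, x) = (c, min x (Y 0))"
proof -
  have overlap: "overlapping xs" using table by (simp add: skip_table_def)
  have "(A 0, Y 0) = scan_from xs 0" using table assms(3) by (simp add: skip_table_def)
  then have "Y 0 = Min (snd ` set xs)" using scan_from_overlapping[of 0 xs] overlap assms(3) by simp
  then show ?thesis using fold_step_overlapping[OF overlap assms(2,4)] assms(3) by simp
qed

subsection \<open>Building the table from right to left\<close>

text \<open>\<open>A\<close> and \<open>Y\<close> are correct from position \<open>p\<close> on; \<open>q\<close> is an upper bound for the end of the
  overlapping window that starts at \<open>p - 1\<close>.\<close>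

definition table_suffix ::
  "interval list \<Rightarrow> nat \<Rightarrow> nat \<Rightarrow> (nat \<Rightarrow> nat) \<Rightarrow> (nat \<Rightarrow> real) \<Rightarrow> bool" where
  "table_suffix xs p q A Y \<longleftrightarrow> p \<le> q \<and> q \<le> length xs \<and> overlapping (drop p (take q xs)) \<and>
     (q < length xs \<longrightarrow> (\<exists>i\<in>set (drop (p - 1) (take q xs)). snd i < fst (xs ! q))) \<and>
     (\<forall>i<length xs. p \<le> i \<longrightarrow> (A i, Y i) = scan_from xs i)"

lemma table_suffix_init: "table_suffix xs (length xs) (length xs) A Y"
  by (simp add: table_suffix_def overlapping_def)

lemma table_suffix_0: "table_suffix xs 0 q A Y \<Longrightarrow> skip_table xs q A Y"
  by (simp add: table_suffix_def skip_table_def)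

lemma table_suffix_shrink:
  assumes suffix: "table_suffix xs p (Suc q) A Y" and p: "0 < p" "p \<le> q"
    and conflict: "snd (xs ! (p - 1)) < fst (xs ! q)"
  shows "table_suffix xs p q A Y"
proof -
  have q: "q < length xs" using suffix by (simp add: table_suffix_def)
  then have "drop p (take (Suc q) xs) = drop p (take q xs) @ [xs ! q]"
    using p by (simp add: take_Suc_conv_app_nth)
  then have "overlapping (drop p (take q xs))"
    using suffix by (simp add: table_suffix_def overlapping_def sorted_wrt_append)
  moreover have "xs ! (p - 1) \<in> set (drop (p - 1) (take q xs))"
    using window_Cons[of "p - 1" q xs] p q by simp
  ultimately show ?thesis using suffix p conflict q by (auto simp: table_suffix_def)
qed

context
  fixes xs k q A Y
  assumes suffix: "table_suffix xs (Suc k) q A Y" and sorted: "start_sorted xs"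
    and no_conflict: "Suc k < q \<Longrightarrow> fst (xs ! (q - 1)) \<le> snd (xs ! k)"
begin

lemma window_bounds: "k < q" "q \<le> length xs"
  using suffix by (auto simp: table_suffix_def)

lemma overlapping_extended_window: "overlapping (drop k (take q xs))"
proof -
  have "fst j \<le> snd (xs ! k)" if j: "j \<in> set (drop (Suc k) (take q xs))" for j
  proof -
    obtain n where "n < length (drop (Suc k) (take q xs))" "drop (Suc k) (take q xs) ! n = j"
      using j by (meson in_set_conv_nth)
    then have n: "Suc k + n < q" "j = xs ! (Suc k + n)" using window_bounds by auto
    have q: "q - 1 < length xs" using n window_bounds by simp
    consider "Suc k + n = q - 1" | "Suc k + n < q - 1" using n by linarith
    then have "fst j \<le> fst (xs ! (q - 1))"
      by cases (use n sorted_wrt_nth_less[OF sorted _ q] in \<open>auto intro: less_imp_le\<close>)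
    then show ?thesis using no_conflict n by simp
  qed
  then show ?thesis
    using suffix window_Cons[OF window_bounds] by (simp add: table_suffix_def overlapping_def)
qed

lemma table_suffix_extend:
  assumes "(A' k, Y' k) = scan_from xs k" "\<And>i. i \<noteq> k \<Longrightarrow> A' i = A i \<and> Y' i = Y i"
  shows "table_suffix xs k q A' Y'"
proof -
  have "(A' i, Y' i) = scan_from xs i" if "i < length xs" "k \<le> i" for i
    using assms suffix that by (cases "i = k") (auto simp: table_suffix_def)
  moreover have "set (drop k (take q xs)) \<subseteq> set (drop (k - 1) (take q xs))"
    by (rule set_drop_subset_set_drop) simp
  ultimately show ?thesis using suffix overlapping_extended_window window_bounds
    by (auto simp: table_suffix_def)
qed

lemma table_suffix_extend_conflict:
  assumes "q < length xs"
  shows "table_suffix xs k q (A(k := A q + 1)) (Y(k := Y q))"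
proof (rule table_suffix_extend)
  have "\<exists>i\<in>set (drop k (take q xs)). snd i < fst (xs ! q)"
    using suffix assms by (simp add: table_suffix_def)
  then have "scan_from xs k = apfst Suc (scan_from xs q)"
    using scan_from_conflict overlapping_extended_window window_bounds assms by blast
  moreover have "(A q, Y q) = scan_from xs q"
    using suffix assms window_bounds by (simp add: table_suffix_def)
  ultimately show "((A(k := A q + 1)) k, (Y(k := Y q)) k) = scan_from xs k"
    by (metis Suc_eq_plus1 apfst_conv fun_upd_same)
qed simp

lemma table_suffix_extend_overlapping:
  assumes "q = length xs"
  shows "table_suffix xs k q (A(k := 1))
    (Y(k := if Suc k < length xs \<and> Y (Suc k) < snd (xs ! k) then Y (Suc k) else snd (xs ! k)))"
proof (rule table_suffix_extend)
  have "snd (scan_from xs (Suc k)) = Y (Suc k)" if "Suc k < length xs"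
    using suffix that unfolding table_suffix_def by (metis le_refl snd_conv)
  moreover have "overlapping (drop k xs)" using overlapping_extended_window assms by simp
  ultimately show "((A(k := 1)) k, (Y(k := if Suc k < length xs \<and> Y (Suc k) < snd (xs ! k)
      then Y (Suc k) else snd (xs ! k))) k) = scan_from xs k"
    using scan_from_overlapping_Suc[of k xs] window_bounds assms by auto
qed simp

end

section \<open>Blocks in memory\<close>

definition subarray :: "nat \<Rightarrow> (nat \<Rightarrow> 'a) \<Rightarrow> nat \<Rightarrow> 'a" where
  "subarray k a = (\<lambda>i. a (k + i))"

lemma subarray_apply [simp]: "subarray k a i = a (k + i)"
  by (simp add: subarray_def)

lemma subarray_upd [simp]: "subarray k (a(k + i := v)) = (subarray k a)(i := v)"
  by (simp add: fun_eq_iff)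

definition segment ::
  "(nat \<Rightarrow> real) \<Rightarrow> (nat \<Rightarrow> real) \<Rightarrow> nat \<Rightarrow> nat \<Rightarrow> interval list" where
  "segment S F k n = map (\<lambda>i. (S (k + i), F (k + i))) [0..<n]"

lemma segment_0 [simp]: "segment S F k 0 = []"
  by (simp add: segment_def)

lemma segment_Suc: "segment S F k (Suc n) = segment S F k n @ [(S (k + n), F (k + n))]"
  by (simp add: segment_def)

lemma length_segment [simp]: "length (segment S F k n) = n"
  by (simp add: segment_def)

lemma nth_segment [simp]: "i < n \<Longrightarrow> segment S F k n ! i = (S (k + i), F (k + i))"
  by (simp add: segment_def)

lemma segment_cong:
  assumes "\<And>i. i < n \<Longrightarrow> S' (k' + i) = S (k + i) \<and> F' (k' + i) = F (k + i)"
  shows "segment S' F' k' n = segment S F k n"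
  using assms by (simp add: segment_def)

lemma segment_upd [simp]: "k + n \<le> j \<Longrightarrow> segment (S(j := v)) (F(j := v')) k n = segment S F k n"
  by (rule segment_cong) simp

text \<open>Block \<open>b\<close> of capacity \<open>W\<close> occupies the positions from \<open>b * W\<close> on of the arrays
  \<open>starts\<close> and \<open>finishes\<close>, and its table those of \<open>gain\<close> and \<open>ends\<close>.\<close>

definition block :: "nat \<Rightarrow> memory \<Rightarrow> nat \<Rightarrow> interval list" where
  "block W m b = segment (rarr m ''starts'') (rarr m ''finishes'') (b * W) (iarr m ''size'' b)"

definition has_table :: "nat \<Rightarrow> memory \<Rightarrow> nat \<Rightarrow> bool" where
  "has_table W m b \<longleftrightarrow> skip_table (block W m b) (iarr m ''prefix'' b)
     (subarray (b * W) (iarr m ''gain'')) (subarray (b * W) (rarr m ''ends''))"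

definition contents :: "nat \<Rightarrow> nat \<Rightarrow> memory \<Rightarrow> interval list" where
  "contents W n m = concat (map (block W m) [0..<n])"

lemma length_block [simp]: "length (block W m b) = iarr m ''size'' b"
  by (simp add: block_def)

lemma block_ivar [simp]: "block W (m\<lparr>ivar := v\<rparr>) b = block W m b"
  by (simp add: block_def)

lemma has_table_ivar [simp]: "has_table W (m\<lparr>ivar := v\<rparr>) b \<longleftrightarrow> has_table W m b"
  by (simp add: has_table_def)

lemma nth_block: "i < iarr m ''size'' b \<Longrightarrow>
  block W m b ! i = (rarr m ''starts'' (b * W + i), rarr m ''finishes'' (b * W + i))"
  by (simp add: block_def)

lemma contents_0 [simp]: "contents W 0 m = []"
  by (simp add: contents_def)

lemma contents_Suc: "contents W (Suc n) m = contents W n m @ block W m n"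
  by (simp add: contents_def)

lemma contents_split:
  assumes "b < n"
  shows "contents W n m = contents W b m @ block W m b @ concat (map (block W m) [Suc b..<n])"
proof -
  have "[0..<n] = [0..<b] @ b # [Suc b..<n]"
    using assms upt_add_eq_append[of 0 b "n - b"] by (simp add: upt_conv_Cons)
  then show ?thesis by (simp add: contents_def)
qed

lemma contents_cong:
  assumes "\<And>b. b < n \<Longrightarrow> block W m' b = block W m b"
  shows "contents W n m' = contents W n m"
  unfolding contents_def using assms by (intro arg_cong[where f = concat] map_cong) auto

lemma start_sorted_block: "start_sorted (contents W n m) \<Longrightarrow> b < n \<Longrightarrow> start_sorted (block W m b)"
  by (simp add: contents_split sorted_wrt_append)

lemma start_sorted_contents_le:
  "start_sorted (contents W n m) \<Longrightarrow> k \<le> n \<Longrightarrow> start_sorted (contents W k m)"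
  using contents_split[of k n W m] by (cases "k = n") (simp_all add: sorted_wrt_append)

lemma length_contents_le:
  assumes "\<forall>b<n. iarr m ''size'' b \<le> W"
  shows "length (contents W n m) \<le> n * W"
  using assms
proof (induction n)
  case (Suc n)
  then have "length (contents W n m) \<le> n * W" "iarr m ''size'' n \<le> W" by auto
  then show ?case by (simp add: contents_Suc)
qed simp

definition same_block :: "nat \<Rightarrow> memory \<Rightarrow> memory \<Rightarrow> nat \<Rightarrow> bool" where
  "same_block W m m' b \<longleftrightarrow> iarr m' ''size'' b = iarr m ''size'' b \<and>
     iarr m' ''prefix'' b = iarr m ''prefix'' b \<and>
     (\<forall>i<W. rarr m' ''starts'' (b * W + i) = rarr m ''starts'' (b * W + i) \<and>
        rarr m' ''finishes'' (b * W + i) = rarr m ''finishes'' (b * W + i) \<and>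
        rarr m' ''ends'' (b * W + i) = rarr m ''ends'' (b * W + i) \<and>
        iarr m' ''gain'' (b * W + i) = iarr m ''gain'' (b * W + i))"

lemma block_same_block: "same_block W m m' b \<Longrightarrow> iarr m ''size'' b \<le> W \<Longrightarrow> block W m' b = block W m b"
  by (auto simp: same_block_def block_def intro!: segment_cong)

lemma has_table_same_block:
  assumes "same_block W m m' b" "iarr m ''size'' b \<le> W"
  shows "has_table W m' b \<longleftrightarrow> has_table W m b"
  unfolding has_table_def block_same_block[OF assms] using assms
  by (auto simp: same_block_def intro!: skip_table_cong)

definition same_other_blocks :: "nat \<Rightarrow> nat \<Rightarrow> memory \<Rightarrow> memory \<Rightarrow> bool" where
  "same_other_blocks W b m m' \<longleftrightarrow> (\<forall>b'. b' \<noteq> b \<longrightarrow> same_block W m m' b')"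

lemma block_index_eq_iff:
  fixes b b' W i j :: nat
  assumes "i < W" "j < W"
  shows "b * W + i = b' * W + j \<longleftrightarrow> b = b' \<and> i = j"
proof
  assume eq: "b * W + i = b' * W + j"
  have "(b * W + i) div W = b" "(b' * W + j) div W = b'" using assms by simp_all
  then show "b = b' \<and> i = j" using eq by simp
qed simp

section \<open>Building the table of a block\<close>

definition block_selected :: "nat \<Rightarrow> nat \<Rightarrow> nat \<Rightarrow> memory \<Rightarrow> bool" where
  "block_selected w W b m \<longleftrightarrow> ivar m ''b'' = b \<and> ivar m ''capacity'' = W \<and>
     iarr m ''size'' b \<le> W \<and> (b + 3) * (W + 1) < 2 ^ w"

definition block_loaded :: "nat \<Rightarrow> nat \<Rightarrow> nat \<Rightarrow> memory \<Rightarrow> bool" where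
  "block_loaded w W b m \<longleftrightarrow> block_selected w W b m \<and>
     ivar m ''base'' = b * W \<and> ivar m ''len'' = iarr m ''size'' b"

lemma block_loadedD:
  assumes "block_loaded w W b m"
  shows "ivar m ''b'' = b" "ivar m ''capacity'' = W" "ivar m ''base'' = b * W"
    "ivar m ''len'' = iarr m ''size'' b" "iarr m ''size'' b \<le> W" "b * W + 3 * W + b + 3 < 2 ^ w"
  using assms by (auto simp: block_loaded_def block_selected_def algebra_simps)

definition select_block :: com where
  "select_block = ''base'' ::= \<acute>''b'' \<otimes> \<acute>''capacity'' ;; ''len'' ::= ''size''\<lbrakk>\<acute>''b''\<rbrakk>"

lemma modified_select_block [simp]: "modified select_block = {IReg ''base'', IReg ''len''}"
  by (auto simp: select_block_def)

lemma exec_within_select_block: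
  assumes "block_selected w W b m"
    and "\<And>m'. block_loaded w W b m' \<Longrightarrow> agree_outside {IReg ''base'', IReg ''len''} m m' \<Longrightarrow>
      exec_within w c m' T Q"
    and "T + 7 \<le> T'"
  shows "exec_within w (select_block ;; c) m T' Q"
proof (rule exec_within_Seq)
  have "b * W + 3 * W + b + 3 < 2 ^ w"
    using assms(1) by (simp add: block_selected_def algebra_simps)
  then show "exec_within w select_block m 7 (block_loaded w W b)"
    using assms(1)
    by (intro exec_within_wp) (auto simp: select_block_def block_loaded_def block_selected_def)
qed (use assms in auto)

abbreviation cell :: "iexp \<Rightarrow> iexp" where
  "cell e \<equiv> \<acute>''base'' \<oplus> e"

definition extend_table :: com where
  "extend_table =
     ''p'' ::= \<acute>''p'' \<ominus> Num 1 ;;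
     IF \<acute>''q'' <\<^sub>i \<acute>''len''
     THEN
       (''gain''\<lbrakk>cell \<acute>''p''\<rbrakk> ::= ''gain''\<lbrakk>cell \<acute>''q''\<rbrakk> \<oplus> Num 1 ;;
        ''ends''\<lbrakk>cell \<acute>''p''\<rbrakk> ::=\<^sub>r ''ends''\<lbrakk>cell \<acute>''q''\<rbrakk>\<^sub>r)
     ELSE
       (''gain''\<lbrakk>cell \<acute>''p''\<rbrakk> ::= Num 1 ;;
        IF \<acute>''p'' \<oplus> Num 1 <\<^sub>i \<acute>''len'' AND
           ''ends''\<lbrakk>cell (\<acute>''p'' \<oplus> Num 1)\<rbrakk>\<^sub>r <\<^sub>r ''finishes''\<lbrakk>cell \<acute>''p''\<rbrakk>\<^sub>r
        THEN ''ends''\<lbrakk>cell \<acute>''p''\<rbrakk> ::=\<^sub>r ''ends''\<lbrakk>cell (\<acute>''p'' \<oplus> Num 1)\<rbrakk>\<^sub>r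
        ELSE ''ends''\<lbrakk>cell \<acute>''p''\<rbrakk> ::=\<^sub>r ''finishes''\<lbrakk>cell \<acute>''p''\<rbrakk>\<^sub>r)"

definition table_step :: com where
  "table_step =
     IF \<acute>''p'' <\<^sub>i \<acute>''q'' AND
        ''finishes''\<lbrakk>cell (\<acute>''p'' \<ominus> Num 1)\<rbrakk>\<^sub>r <\<^sub>r ''starts''\<lbrakk>cell (\<acute>''q'' \<ominus> Num 1)\<rbrakk>\<^sub>r
     THEN ''q'' ::= \<acute>''q'' \<ominus> Num 1
     ELSE extend_table"

definition build_table :: com where
  "build_table =
     select_block ;; (''p'' ::= \<acute>''len'' ;; ''q'' ::= \<acute>''len'') ;;
     WHILE Num 0 <\<^sub>i \<acute>''p'' DO table_step ;;
     ''prefix''\<lbrakk>\<acute>''b''\<rbrakk> ::= \<acute>''q''"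

lemma modified_table_step [simp]:
  "modified table_step = {IReg ''p'', IReg ''q'', IArray ''gain'', RArray ''ends''}"
  by (auto simp: table_step_def extend_table_def)

lemma modified_build_table [simp]: "modified build_table = {IReg ''base'', IReg ''len'', IReg ''p'',
    IReg ''q'', IArray ''gain'', IArray ''prefix'', RArray ''ends''}"
  by (auto simp: build_table_def)

definition partial_table :: "nat \<Rightarrow> nat \<Rightarrow> memory \<Rightarrow> memory \<Rightarrow> bool" where
  "partial_table W b m m' \<longleftrightarrow>
     table_suffix (block W m b) (ivar m' ''p'') (ivar m' ''q'')
       (subarray (b * W) (iarr m' ''gain'')) (subarray (b * W) (rarr m' ''ends'')) \<and>
     same_other_blocks W b m m'"

lemma table_suffix_gain_le:
  assumes "table_suffix xs p q A Y" "p \<le> i" "i < length xs"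
  shows "A i \<le> length xs"
  using assms fst_scan_from_le[of i xs] unfolding table_suffix_def by (metis fst_conv)

lemma extend_table_correct:
  assumes loaded: "block_loaded w W b m" and partial: "partial_table W b m0 m"
    and block: "block W m b = block W m0 b" and sorted: "start_sorted (block W m0 b)"
    and pq: "ivar m ''p'' = Suc k" "ivar m ''q'' = q"
    and no_conflict: "Suc k < q \<Longrightarrow> fst (block W m0 b ! (q - 1)) \<le> snd (block W m0 b ! k)"
  shows "wp w extend_table (\<lambda>m'. ivar m' ''p'' = k \<and> ivar m' ''q'' = q \<and> partial_table W b m0 m') m"
proof -
  note [simp] = block_loadedD(1-4)[OF loaded] pq and fits = block_loadedD(5,6)[OF loaded]
  let ?xs = "block W m0 b"
  have suffix: "table_suffix ?xs (Suc k) q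
    (subarray (b * W) (iarr m ''gain'')) (subarray (b * W) (rarr m ''ends''))"
    using partial by (simp add: partial_table_def)
  have len: "length ?xs = iarr m ''size'' b" by (simp flip: block)
  have bounds: "k < q" "q \<le> iarr m ''size'' b"
    using window_bounds[OF suffix sorted no_conflict] len by auto
  have same: "b' \<noteq> b \<Longrightarrow> same_block W m0 m b'" for b'
    using partial by (simp add: partial_table_def same_other_blocks_def)
  have other: "b' * W + i \<noteq> b * W + k" if "b' \<noteq> b" "i < W" for b' i
    using block_index_eq_iff[of i W k b' b] that bounds fits by simp
  show ?thesis
  proof (cases "q < iarr m ''size'' b")
    case True
    have "iarr m ''gain'' (b * W + q) \<le> iarr m ''size'' b"
      using table_suffix_gain_le[OF suffix, of q] True bounds len by simp
    then show ?thesis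
      using True fits bounds same table_suffix_extend_conflict[OF suffix sorted no_conflict] len
      by (simp add: extend_table_def partial_table_def same_other_blocks_def same_block_def other)
  next
    case False
    have "snd (?xs ! k) = rarr m ''finishes'' (b * W + k)"
      using bounds by (simp add: nth_block flip: block)
    then show ?thesis
      using False fits bounds same table_suffix_extend_overlapping[OF suffix sorted no_conflict] len
      by (auto simp: extend_table_def partial_table_def same_other_blocks_def same_block_def other)
  qed
qed

lemma table_step_correct:
  assumes loaded: "block_loaded w W b m" and partial: "partial_table W b m0 m"
    and block: "block W m b = block W m0 b" and sorted: "start_sorted (block W m0 b)"
    and p: "0 < ivar m ''p''"
  shows "wp w table_step (\<lambda>m'. ivar m' ''p'' + ivar m' ''q'' < ivar m ''p'' + ivar m ''q'' \<and>
    partial_table W b m0 m') m"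
proof -
  note [simp] = block_loadedD(1-4)[OF loaded] and fits = block_loadedD(5,6)[OF loaded]
  let ?xs = "block W m0 b"
  have suffix: "table_suffix ?xs (ivar m ''p'') (ivar m ''q'')
    (subarray (b * W) (iarr m ''gain'')) (subarray (b * W) (rarr m ''ends''))"
    using partial by (simp add: partial_table_def)
  have len: "length ?xs = iarr m ''size'' b" by (simp flip: block)
  obtain k where k: "ivar m ''p'' = Suc k" using p by (cases "ivar m ''p''") auto
  then obtain q where q: "ivar m ''q'' = Suc q"
    using suffix by (cases "ivar m ''q''") (auto simp: table_suffix_def)
  have bounds: "k \<le> q" "q < iarr m ''size'' b"
    using suffix k q len by (auto simp: table_suffix_def)
  have nth: "snd (?xs ! k) = rarr m ''finishes'' (b * W + k)"
    "fst (?xs ! q) = rarr m ''starts'' (b * W + q)"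
    using bounds by (simp_all add: nth_block flip: block)
  show ?thesis
  proof (cases "k < q \<and> snd (?xs ! k) < fst (?xs ! q)")
    case True
    have "table_suffix ?xs (Suc k) q
      (subarray (b * W) (iarr m ''gain'')) (subarray (b * W) (rarr m ''ends''))"
      by (rule table_suffix_shrink[OF suffix[unfolded k q]]) (use True in simp_all)
    then show ?thesis using True partial k q bounds fits nth
      by (simp add: table_step_def partial_table_def same_other_blocks_def same_block_def)
  next
    case False
    then have "wp w extend_table (\<lambda>m'. ivar m' ''p'' = k \<and> ivar m' ''q'' = Suc q \<and>
        partial_table W b m0 m') m"
      using extend_table_correct[OF loaded partial block sorted k q] by auto
    then have "wp w extend_table (\<lambda>m'. ivar m' ''p'' + ivar m' ''q'' < ivar m ''p'' + ivar m ''q'' \<and>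
        partial_table W b m0 m') m"
      by (rule wp_mono) (simp add: k q)
    then show ?thesis using False k q bounds fits nth by (auto simp: table_step_def)
  qed
qed

lemma table_loop_correct:
  assumes loaded: "block_loaded w W b m" and sorted: "start_sorted (block W m b)"
    and pq: "ivar m ''p'' = iarr m ''size'' b" "ivar m ''q'' = iarr m ''size'' b"
  shows "exec_within w (WHILE Num 0 <\<^sub>i \<acute>''p'' DO table_step) m (132 * W + 4)
    (\<lambda>m'. partial_table W b m m' \<and> ivar m' ''p'' = 0)"
proof (rule exec_within_While[where C = "cost table_step" and r = "2 * iarr m ''size'' b" and
      I = "\<lambda>r m'. r = ivar m' ''p'' + ivar m' ''q'' \<and> partial_table W b m m'"])
  note [simp] = block_loadedD(1-4)[OF loaded] and fits = block_loadedD(5,6)[OF loaded]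
  show "2 * iarr m ''size'' b = ivar m ''p'' + ivar m ''q'' \<and> partial_table W b m m"
    using table_suffix_init[of "block W m b"] pq
    by (simp add: partial_table_def same_other_blocks_def same_block_def)
  show "2 * iarr m ''size'' b * (cost table_step + bcost (Num 0 <\<^sub>i \<acute>''p'') + 1) +
      bcost (Num 0 <\<^sub>i \<acute>''p'') + 1 \<le> 132 * W + 4"
    using fits by (simp add: table_step_def extend_table_def)
  fix r m'
  assume inv: "r = ivar m' ''p'' + ivar m' ''q'' \<and> partial_table W b m m'"
    and "agree_outside (modified table_step) m m'"
  note [simp] = agree_outsideD[OF this(2)]
  have bounds: "ivar m' ''p'' \<le> ivar m' ''q''" "ivar m' ''q'' \<le> iarr m ''size'' b"
    using inv by (auto simp: partial_table_def table_suffix_def)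
  show "bfits w (Num 0 <\<^sub>i \<acute>''p'') m'" using bounds fits by simp
  show "partial_table W b m m' \<and> ivar m' ''p'' = 0" if "\<not> bval (Num 0 <\<^sub>i \<acute>''p'') m'"
    using that inv by simp
  have "block_loaded w W b m'"
    using loaded by (simp add: block_loaded_def block_selected_def)
  moreover have "block W m' b = block W m b" by (simp add: block_def)
  moreover assume "bval (Num 0 <\<^sub>i \<acute>''p'') m'"
  ultimately have "wp w table_step (\<lambda>m''. ivar m'' ''p'' + ivar m'' ''q'' < r \<and>
      partial_table W b m m'') m'"
    using table_step_correct[of w W b m' m] inv sorted by simp
  then show "exec_within w table_step m' (cost table_step) (\<lambda>m''. \<exists>r'<r.
      r' = ivar m'' ''p'' + ivar m'' ''q'' \<and> partial_table W b m m'')"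
    by (auto intro: exec_within_weaken[OF exec_within_cost])
qed

lemma build_table_correct:
  assumes selected: "block_selected w W b m" and sorted: "start_sorted (block W m b)"
  shows "exec_within w build_table m (132 * W + 20)
    (\<lambda>m'. has_table W m' b \<and> same_other_blocks W b m m')"
  unfolding build_table_def
proof (rule exec_within_select_block[OF selected])
  fix m1
  assume loaded: "block_loaded w W b m1"
    and agree: "agree_outside {IReg ''base'', IReg ''len''} m m1"
  note [simp] = block_loadedD(1-4)[OF loaded] agree_outsideD[OF agree]
    and fits = block_loadedD(5,6)[OF loaded]
  let ?Q = "\<lambda>m'. has_table W m' b \<and> same_other_blocks W b m m'"
  let ?m = "m1\<lparr>ivar := (ivar m1)(''p'' := iarr m ''size'' b, ''q'' := iarr m ''size'' b)\<rparr>"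
  have "exec_within w (WHILE Num 0 <\<^sub>i \<acute>''p'' DO table_step) ?m (132 * W + 4)
      (\<lambda>m'. partial_table W b ?m m' \<and> ivar m' ''p'' = 0)"
    using loaded sorted
    by (intro table_loop_correct) (auto simp: block_loaded_def block_selected_def block_def)
  then have "exec_within w (WHILE Num 0 <\<^sub>i \<acute>''p'' DO table_step ;;
      ''prefix''\<lbrakk>\<acute>''b''\<rbrakk> ::= \<acute>''q'') ?m (132 * W + 7) ?Q"
  proof (rule exec_within_Seq)
    fix m'
    assume "agree_outside (modified (WHILE Num 0 <\<^sub>i \<acute>''p'' DO table_step)) ?m m'"
      and partial: "partial_table W b ?m m' \<and> ivar m' ''p'' = 0"
    note [simp] = agree_outsideD[OF this(1)]
    have "table_suffix (block W m b) 0 (ivar m' ''q'')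
        (subarray (b * W) (iarr m' ''gain'')) (subarray (b * W) (rarr m' ''ends''))"
      using partial by (auto simp: partial_table_def block_def)
    then show "exec_within w (''prefix''\<lbrakk>\<acute>''b''\<rbrakk> ::= \<acute>''q'') m' 3 ?Q"
      using partial fits table_suffix_0
      by (intro exec_within_wp)
        (auto simp: has_table_def partial_table_def same_other_blocks_def same_block_def block_def
          table_suffix_def)
  qed simp
  then show "exec_within w ((''p'' ::= \<acute>''len'' ;; ''q'' ::= \<acute>''len'') ;;
      WHILE Num 0 <\<^sub>i \<acute>''p'' DO table_step ;; ''prefix''\<lbrakk>\<acute>''b''\<rbrakk> ::= \<acute>''q'') m1 (132 * W + 11) ?Q"
    using fits by (intro exec_within_Seq_wp[where ?T2.0 = "132 * W + 7"]) simp_all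
qed simp

section \<open>Answering by binary search in the blocks\<close>

definition block_store :: "nat \<Rightarrow> nat \<Rightarrow> nat \<Rightarrow> memory \<Rightarrow> bool" where
  "block_store w J W m \<longleftrightarrow> ivar m ''blocks'' = J \<and> ivar m ''capacity'' = W \<and>
     (\<forall>b<J. iarr m ''size'' b \<le> W) \<and> (J + 2) * (W + 1) < 2 ^ w"

lemma block_storeD:
  assumes "block_store w J W m"
  shows "ivar m ''blocks'' = J" "ivar m ''capacity'' = W" "b < J \<Longrightarrow> iarr m ''size'' b \<le> W"
    "J * W + J + 2 * W + 2 < 2 ^ w"
  using assms by (auto simp: block_store_def)

lemma block_store_selected:
  assumes "block_store w J W m" "b < J" "ivar m ''b'' = b"
  shows "block_selected w W b m"
proof -
  have "(b + 3) * (W + 1) \<le> (J + 2) * (W + 1)" using assms(2) by (intro mult_le_mono1) simp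
  then show ?thesis using assms by (auto simp: block_store_def block_selected_def)
qed

definition search_step :: com where
  "search_step =
     ''mid'' ::= (\<acute>''lo'' \<oplus> \<acute>''hi'') \<oslash> Num 2 ;;
     IF RVar ''last'' <\<^sub>r ''starts''\<lbrakk>cell \<acute>''mid''\<rbrakk>\<^sub>r
     THEN ''hi'' ::= \<acute>''mid''
     ELSE ''lo'' ::= \<acute>''mid'' \<oplus> Num 1"

definition search :: com where
  "search = WHILE \<acute>''lo'' <\<^sub>i \<acute>''hi'' DO search_step"

definition apply_table :: com where
  "apply_table =
     IF \<acute>''lo'' <\<^sub>i \<acute>''len''
     THEN
       (''answer'' ::= \<acute>''answer'' \<oplus> ''gain''\<lbrakk>cell \<acute>''lo''\<rbrakk> ;;
        ''last'' ::=\<^sub>r ''ends''\<lbrakk>cell \<acute>''lo''\<rbrakk>\<^sub>r)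
     ELSE
       (IF ''ends''\<lbrakk>\<acute>''base''\<rbrakk>\<^sub>r <\<^sub>r RVar ''last''
        THEN ''last'' ::=\<^sub>r ''ends''\<lbrakk>\<acute>''base''\<rbrakk>\<^sub>r
        ELSE SKIP)"

definition process_nonempty_block :: com where
  "process_nonempty_block =
     (''lo'' ::= Num 0 ;;
      IF Num 0 <\<^sub>i \<acute>''answer'' THEN ''hi'' ::= ''prefix''\<lbrakk>\<acute>''b''\<rbrakk> ELSE ''hi'' ::= Num 0) ;;
     search ;;
     apply_table"

definition process_block :: com where
  "process_block =
     select_block ;;
     IF Num 0 <\<^sub>i \<acute>''len'' THEN process_nonempty_block ELSE SKIP"

definition compute_answer :: com where
  "compute_answer = ''answer'' ::= Num 0 ;; FOR ''b'' < ''blocks'' DO process_block"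

lemma modified_search_step [simp]: "modified search_step = {IReg ''mid'', IReg ''lo'', IReg ''hi''}"
  by (auto simp: search_step_def)

lemma modified_search [simp]: "modified search = {IReg ''mid'', IReg ''lo'', IReg ''hi''}"
  by (auto simp: search_def)

lemma modified_process_block [simp]: "modified process_block = {IReg ''base'', IReg ''len'',
    IReg ''mid'', IReg ''lo'', IReg ''hi'', IReg ''answer'', RReg ''last''}"
  by (auto simp: process_block_def process_nonempty_block_def apply_table_def)

lemma modified_compute_answer [simp]: "modified compute_answer = {IReg ''b'', IReg ''base'',
    IReg ''len'', IReg ''mid'', IReg ''lo'', IReg ''hi'', IReg ''answer'', RReg ''last''}"
  by (auto simp: compute_answer_def)

definition scan_state :: "memory \<Rightarrow> nat \<times> real" where
  "scan_state m = (ivar m ''answer'', rvar m ''last'')"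

lemma scan_state_ivar [simp]:
  "x \<noteq> ''answer'' \<Longrightarrow> scan_state (m\<lparr>ivar := (ivar m)(x := v)\<rparr>) = scan_state m"
  by (simp add: scan_state_def)

definition first_start_after :: "interval list \<Rightarrow> nat \<Rightarrow> real \<Rightarrow> nat \<Rightarrow> bool" where
  "first_start_after xs n x p \<longleftrightarrow>
     p \<le> n \<and> (\<forall>j<p. fst (xs ! j) \<le> x) \<and> (p < n \<longrightarrow> x < fst (xs ! p))"

definition search_window :: "interval list \<Rightarrow> nat \<Rightarrow> real \<Rightarrow> memory \<Rightarrow> bool" where
  "search_window xs n x m \<longleftrightarrow> ivar m ''lo'' \<le> ivar m ''hi'' \<and> ivar m ''hi'' \<le> n \<and>
     (\<forall>j<ivar m ''lo''. fst (xs ! j) \<le> x) \<and> (ivar m ''hi'' < n \<longrightarrow> x < fst (xs ! ivar m ''hi''))"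

lemma search_step_correct:
  assumes loaded: "block_loaded w W b m" and sorted: "start_sorted (block W m b)"
    and n: "n \<le> iarr m ''size'' b" and window: "search_window (block W m b) n (rvar m ''last'') m"
    and less: "ivar m ''lo'' < ivar m ''hi''"
  shows "wp w search_step (\<lambda>m'. search_window (block W m b) n (rvar m ''last'') m' \<and>
    2 * (ivar m' ''hi'' - ivar m' ''lo'') \<le> ivar m ''hi'' - ivar m ''lo'') m"
proof -
  note [simp] = block_loadedD(1-4)[OF loaded] and fits = block_loadedD(5,6)[OF loaded]
  let ?s = "\<lambda>j. fst (block W m b ! j)" and ?x = "rvar m ''last''"
  let ?lo = "ivar m ''lo''" and ?hi = "ivar m ''hi''"
  let ?mid = "(?lo + ?hi) div 2"
  have bounds: "?lo \<le> ?mid" "?mid < ?hi" "?hi \<le> iarr m ''size'' b"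
    using less n window by (auto simp: search_window_def)
  have halves: "2 * (?hi - Suc ?mid) \<le> ?hi - ?lo" "2 * (?mid - ?lo) \<le> ?hi - ?lo" using less by auto
  have "?s j \<le> ?s ?mid" if "j < Suc ?mid" for j
    using sorted_wrt_nth_less[OF sorted, of j ?mid] that bounds by (cases "j = ?mid") auto
  then have "?s j \<le> ?x" if "?s ?mid \<le> ?x" "j < Suc ?mid" for j
    using that order_trans by blast
  moreover have "?s ?mid = rarr m ''starts'' (b * W + ?mid)" using bounds by (simp add: nth_block)
  ultimately show ?thesis
    using window n bounds halves fits by (auto simp: search_step_def search_window_def)
qed

lemma search_correct:
  assumes loaded: "block_loaded w W b m" and sorted: "start_sorted (block W m b)"
    and bounds: "ivar m ''lo'' = 0" "ivar m ''hi'' = n" "n \<le> iarr m ''size'' b" and L: "W < 2 ^ L"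
  shows "exec_within w search m (21 * L + 4)
    (\<lambda>m'. first_start_after (block W m b) n (rvar m ''last'') (ivar m' ''lo''))"
  unfolding search_def
proof (rule exec_within_While[where C = "cost search_step" and r = L and
      I = "\<lambda>r m'. search_window (block W m b) n (rvar m ''last'') m' \<and>
        ivar m' ''hi'' - ivar m' ''lo'' < 2 ^ r"])
  note fits = block_loadedD(5,6)[OF loaded]
  let ?window = "search_window (block W m b) n (rvar m ''last'')"
  show "?window m \<and> ivar m ''hi'' - ivar m ''lo'' < 2 ^ L"
    using bounds fits L by (simp add: search_window_def)
  fix r m'
  assume inv: "?window m' \<and> ivar m' ''hi'' - ivar m' ''lo'' < 2 ^ r"
    and "agree_outside (modified search_step) m m'"
  note [simp] = agree_outsideD[OF this(2)]
  show "bfits w (\<acute>''lo'' <\<^sub>i \<acute>''hi'') m'" using inv bounds fits by (simp add: search_window_def)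
  show "first_start_after (block W m b) n (rvar m ''last'') (ivar m' ''lo'')"
    if "\<not> bval (\<acute>''lo'' <\<^sub>i \<acute>''hi'') m'"
    using that inv by (simp add: first_start_after_def search_window_def)
  assume less: "bval (\<acute>''lo'' <\<^sub>i \<acute>''hi'') m'"
  then obtain k where k: "r = Suc k" using inv by (cases r) auto
  have [simp]: "block W m' b = block W m b" by (simp add: block_def)
  have "block_loaded w W b m'" using loaded by (simp add: block_loaded_def block_selected_def)
  then have "wp w search_step (\<lambda>m''. ?window m'' \<and>
      2 * (ivar m'' ''hi'' - ivar m'' ''lo'') \<le> ivar m' ''hi'' - ivar m' ''lo'') m'"
    using search_step_correct[of w W b m' n] sorted bounds inv less by simp
  then show "exec_within w search_step m' (cost search_step) (\<lambda>m''. \<exists>r'<r. ?window m'' \<and>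
      ivar m'' ''hi'' - ivar m'' ''lo'' < 2 ^ r')"
    by (rule exec_within_weaken[OF exec_within_cost]) (use inv k in \<open>auto intro!: exI[of _ k]\<close>)
qed (simp add: search_step_def)

lemma apply_table_correct:
  assumes loaded: "block_loaded w W b m" and table: "has_table W m b"
    and nonempty: "0 < iarr m ''size'' b" and fits: "ivar m ''answer'' + iarr m ''size'' b < 2 ^ w"
    and lo: "first_start_after (block W m b)
      (if ivar m ''answer'' = 0 then 0 else iarr m ''prefix'' b) (rvar m ''last'') (ivar m ''lo'')"
  shows "wp w apply_table (\<lambda>m'. scan_state m' = fold step (block W m b) (scan_state m)) m"
proof -
  note [simp] = block_loadedD(1-4)[OF loaded] and index_fits = block_loadedD(5,6)[OF loaded]
  let ?xs = "block W m b" and ?c = "ivar m ''answer''" and ?x = "rvar m ''last''"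
  let ?p = "ivar m ''lo''" and ?N = "iarr m ''prefix'' b"
  have table: "skip_table ?xs ?N (subarray (b * W) (iarr m ''gain''))
      (subarray (b * W) (rarr m ''ends''))"
    using table by (simp add: has_table_def)
  have N: "?N \<le> iarr m ''size'' b" using table by (simp add: skip_table_def)
  show ?thesis
  proof (cases "?p < iarr m ''size'' b")
    case True
    have "fold step ?xs (?c, ?x) = (?c + subarray (b * W) (iarr m ''gain'') ?p,
        subarray (b * W) (rarr m ''ends'') ?p)"
      by (rule fold_step_select[OF table]) (use lo True in \<open>auto simp: first_start_after_def\<close>)
    then have "fold step ?xs (?c, ?x) =
        (?c + iarr m ''gain'' (b * W + ?p), rarr m ''ends'' (b * W + ?p))" by simp
    moreover from this have "?c + iarr m ''gain'' (b * W + ?p) < 2 ^ w"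
      using fst_fold_step_le[of ?xs "(?c, ?x)"] fits by simp
    ultimately show ?thesis using True index_fits by (simp add: apply_table_def scan_state_def)
  next
    case False
    then have c: "0 < ?c" and p: "?p = iarr m ''size'' b" "?N = length ?xs"
      using lo N nonempty by (auto simp: first_start_after_def split: if_splits)
    have "\<forall>i\<in>set ?xs. fst i \<le> ?x"
      using lo p by (simp add: first_start_after_def all_set_conv_all_nth)
    then have "fold step ?xs (?c, ?x) = (?c, min ?x (subarray (b * W) (rarr m ''ends'') 0))"
      using c nonempty
      by (intro fold_step_keep[OF table[unfolded p(2)]]) (simp_all flip: length_greater_0_conv)
    then have "fold step ?xs (?c, ?x) = (?c, min ?x (rarr m ''ends'' (b * W)))" by simp
    then show ?thesis using p index_fits by (simp add: apply_table_def scan_state_def min_def)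
  qed
qed

lemma process_nonempty_block_correct:
  assumes loaded: "block_loaded w W b m" and table: "has_table W m b"
    and sorted: "start_sorted (block W m b)" and nonempty: "0 < iarr m ''size'' b"
    and fits: "ivar m ''answer'' + iarr m ''size'' b < 2 ^ w" and L: "W < 2 ^ L"
  shows "exec_within w process_nonempty_block m (21 * L + 40)
    (\<lambda>m'. scan_state m' = fold step (block W m b) (scan_state m))"
proof -
  note [simp] = block_loadedD(1-4)[OF loaded] and index_fits = block_loadedD(5,6)[OF loaded]
  let ?n = "if ivar m ''answer'' = 0 then 0 else iarr m ''prefix'' b"
  let ?m = "m\<lparr>ivar := (ivar m)(''lo'' := 0, ''hi'' := ?n)\<rparr>"
  let ?Q = "\<lambda>m'. scan_state m' = fold step (block W m b) (scan_state m)"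
  have n: "iarr m ''prefix'' b \<le> iarr m ''size'' b"
    using table by (simp add: has_table_def skip_table_def)
  have "exec_within w (search ;; apply_table) ?m (21 * L + 22) ?Q"
  proof (rule exec_within_Seq)
    show "exec_within w search ?m (21 * L + 4)
        (\<lambda>m'. first_start_after (block W ?m b) ?n (rvar ?m ''last'') (ivar m' ''lo''))"
      using loaded sorted n L
      by (intro search_correct) (auto simp: block_loaded_def block_selected_def block_def)
  next
    fix m1
    assume "agree_outside (modified search) ?m m1"
      and lo: "first_start_after (block W ?m b) ?n (rvar ?m ''last'') (ivar m1 ''lo'')"
    note [simp] = agree_outsideD[OF this(1)]
    have [simp]: "block W m1 b = block W m b" "scan_state m1 = scan_state m"
      by (simp_all add: block_def scan_state_def)
    have "wp w apply_table (\<lambda>m'. scan_state m' = fold step (block W m1 b) (scan_state m1)) m1"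
      using loaded table nonempty fits lo
      by (intro apply_table_correct) (auto simp: block_loaded_def block_selected_def has_table_def)
    then have "wp w apply_table ?Q m1" by simp
    then show "exec_within w apply_table m1 18 ?Q"
      by (rule exec_within_wp) (simp add: apply_table_def)
  qed simp
  then show ?thesis unfolding process_nonempty_block_def using index_fits fits n
    by (intro exec_within_Seq_wp[where ?T2.0 = "21 * L + 22"])
      (cases "ivar m ''answer'' = 0", simp_all)
qed

lemma process_block_correct:
  assumes selected: "block_selected w W b m" and table: "has_table W m b"
    and sorted: "start_sorted (block W m b)"
    and fits: "ivar m ''answer'' + iarr m ''size'' b < 2 ^ w" and L: "W < 2 ^ L"
  shows "exec_within w process_block m (21 * L + 51)
    (\<lambda>m'. scan_state m' = fold step (block W m b) (scan_state m))"
  unfolding process_block_def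
proof (rule exec_within_select_block[OF selected])
  fix m1
  assume loaded: "block_loaded w W b m1" and "agree_outside {IReg ''base'', IReg ''len''} m m1"
  note [simp] = block_loadedD(1-4)[OF loaded] agree_outsideD[OF this(2)]
    and index_fits = block_loadedD(5,6)[OF loaded]
  have [simp]: "block W m1 b = block W m b" "scan_state m1 = scan_state m"
    by (simp_all add: block_def scan_state_def)
  show "exec_within w (IF Num 0 <\<^sub>i \<acute>''len'' THEN process_nonempty_block ELSE SKIP) m1 (21 * L + 44)
    (\<lambda>m'. scan_state m' = fold step (block W m b) (scan_state m))"
  proof (rule exec_within_Cond)
    assume "bval (Num 0 <\<^sub>i \<acute>''len'') m1"
    then show "exec_within w process_nonempty_block m1 (21 * L + 40)
      (\<lambda>m'. scan_state m' = fold step (block W m b) (scan_state m))"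
      using process_nonempty_block_correct[OF loaded _ _ _ _ L] table sorted fits
      by (simp add: has_table_def)
  next
    assume "\<not> bval (Num 0 <\<^sub>i \<acute>''len'') m1"
    then have "block W m b = []" by (simp flip: length_0_conv)
    then show "exec_within w SKIP m1 (21 * L + 40)
      (\<lambda>m'. scan_state m' = fold step (block W m b) (scan_state m))"
      by (intro exec_within_wp) simp_all
  qed (use index_fits in simp_all)
qed simp

lemma compute_answer_correct:
  assumes store: "block_store w J W m" and sorted: "start_sorted (contents W J m)"
    and tables: "\<forall>b<J. has_table W m b" and L: "W < 2 ^ L"
  shows "exec_within w compute_answer m (J * (21 * L + 59) + 8)
    (\<lambda>m'. ivar m' ''answer'' = fst (fold step (contents W J m) (0, rvar m ''last'')))"
  unfolding compute_answer_def
proof (rule exec_within_init[where T = "J * (21 * L + 59) + 6"],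
    rule exec_within_For[where n = J and C = "21 * L + 51" and
      I = "\<lambda>k m'. scan_state m' = fold step (contents W k m) (0, rvar m ''last'')"])
  note [simp] = block_storeD(1,2)[OF store] and sizes = block_storeD(3)[OF store]
    and fits = block_storeD(4)[OF store]
  let ?m = "m\<lparr>ivar := (ivar m)(''answer'' := 0)\<rparr>"
  let ?scan = "\<lambda>k. fold step (contents W k m) (0, rvar m ''last'')"
  show "scan_state (?m\<lparr>ivar := (ivar ?m)(''b'' := 0)\<rparr>) = ?scan 0" by (simp add: scan_state_def)
  show "J * (21 * L + 59) + 6 + 2 \<le> J * (21 * L + 59) + 8" by simp
  show "ivar m' ''answer'' = fst (?scan J)" if "scan_state m' = ?scan J" for m'
    using that by (metis fst_conv scan_state_def)
  fix k m'
  assume k: "k < J" "ivar m' ''b'' = k" and scan: "scan_state m' = ?scan k"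
    and "agree_outside (insert (IReg ''b'') (modified process_block)) ?m m'"
  note [simp] = agree_outsideD[OF this(4)]
  have [simp]: "block W m' k = block W m k" by (simp add: block_def)
  have "ivar m' ''answer'' = fst (?scan k)" using scan by (metis fst_conv scan_state_def)
  also have "\<dots> \<le> length (contents W k m)"
    using fst_fold_step_le[of "contents W k m" "(0, rvar m ''last'')"] by simp
  also have "\<dots> \<le> k * W" using sizes k by (intro length_contents_le) auto
  finally have "ivar m' ''answer'' \<le> k * W" .
  moreover have "Suc k * W \<le> J * W" using k by (intro mult_le_mono1) simp
  ultimately have "ivar m' ''answer'' + iarr m ''size'' k < 2 ^ w"
    using sizes[OF k(1)] fits by simp
  then have "exec_within w process_block m' (21 * L + 51)
      (\<lambda>m''. scan_state m'' = fold step (block W m' k) (scan_state m'))"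
    using store k tables start_sorted_block[OF sorted k(1)] L
    by (intro process_block_correct block_store_selected[where J = J])
      (simp_all add: block_store_def has_table_def)
  then show "exec_within w process_block m' (21 * L + 51)
      (\<lambda>m''. scan_state (m''\<lparr>ivar := (ivar m'')(''b'' := Suc k)\<rparr>) = ?scan (Suc k))"
    by (simp add: scan contents_Suc)
qed (use block_storeD[OF store] in simp_all)

section \<open>Updating a block\<close>

definition find_step :: com where
  "find_step =
     IF Num 0 <\<^sub>i ''size''\<lbrakk>\<acute>''b''\<rbrakk> AND
        NOT (RVar ''start'' <\<^sub>r ''starts''\<lbrakk>\<acute>''b'' \<otimes> \<acute>''capacity''\<rbrakk>\<^sub>r)
     THEN ''target'' ::= \<acute>''b''
     ELSE SKIP"

definition find_block :: com where
  "find_block =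
     ''target'' ::= Num 0 ;;
     FOR ''b'' < ''blocks'' DO find_step ;;
     ''b'' ::= \<acute>''target''"

definition insert_step :: com where
  "insert_step =
     IF ''starts''\<lbrakk>cell \<acute>''i''\<rbrakk>\<^sub>r <\<^sub>r RVar ''start''
     THEN SKIP
     ELSE
       (''hold'' ::=\<^sub>r ''starts''\<lbrakk>cell \<acute>''i''\<rbrakk>\<^sub>r ;;
        ''starts''\<lbrakk>cell \<acute>''i''\<rbrakk> ::=\<^sub>r RVar ''start'' ;;
        ''start'' ::=\<^sub>r RVar ''hold'' ;;
        ''hold'' ::=\<^sub>r ''finishes''\<lbrakk>cell \<acute>''i''\<rbrakk>\<^sub>r ;;
        ''finishes''\<lbrakk>cell \<acute>''i''\<rbrakk> ::=\<^sub>r RVar ''finish'' ;;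
        ''finish'' ::=\<^sub>r RVar ''hold'')"

definition append_interval :: com where
  "append_interval =
     ''starts''\<lbrakk>cell \<acute>''len''\<rbrakk> ::=\<^sub>r RVar ''start'' ;;
     ''finishes''\<lbrakk>cell \<acute>''len''\<rbrakk> ::=\<^sub>r RVar ''finish'' ;;
     ''size''\<lbrakk>\<acute>''b''\<rbrakk> ::= \<acute>''len'' \<oplus> Num 1"

definition insert_into_block :: com where
  "insert_into_block = select_block ;; FOR ''i'' < ''len'' DO insert_step ;; append_interval"

definition delete_step :: com where
  "delete_step =
     IF NOT (''starts''\<lbrakk>cell \<acute>''i''\<rbrakk>\<^sub>r <\<^sub>r RVar ''start'') AND
        NOT (RVar ''start'' <\<^sub>r ''starts''\<lbrakk>cell \<acute>''i''\<rbrakk>\<^sub>r)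
     THEN SKIP
     ELSE
       (''starts''\<lbrakk>cell \<acute>''kept''\<rbrakk> ::=\<^sub>r ''starts''\<lbrakk>cell \<acute>''i''\<rbrakk>\<^sub>r ;;
        ''finishes''\<lbrakk>cell \<acute>''kept''\<rbrakk> ::=\<^sub>r ''finishes''\<lbrakk>cell \<acute>''i''\<rbrakk>\<^sub>r ;;
        ''kept'' ::= \<acute>''kept'' \<oplus> Num 1)"

definition delete_from_block :: com where
  "delete_from_block =
     select_block ;;
     ''kept'' ::= Num 0 ;;
     FOR ''i'' < ''len'' DO delete_step ;;
     ''size''\<lbrakk>\<acute>''b''\<rbrakk> ::= \<acute>''kept''"

lemma modified_find_step [simp]: "modified find_step = {IReg ''target''}"
  by (auto simp: find_step_def)

lemma modified_find_block [simp]: "modified find_block = {IReg ''target'', IReg ''b''}"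
  by (auto simp: find_block_def)

lemma modified_insert_step [simp]: "modified insert_step =
    {RReg ''hold'', RReg ''start'', RReg ''finish'', RArray ''starts'', RArray ''finishes''}"
  by (auto simp: insert_step_def)

lemma modified_insert_into_block [simp]: "modified insert_into_block =
    {IReg ''base'', IReg ''len'', IReg ''i'', RReg ''hold'', RReg ''start'', RReg ''finish'',
     RArray ''starts'', RArray ''finishes'', IArray ''size''}"
  by (auto simp: insert_into_block_def append_interval_def)

lemma modified_delete_step [simp]:
  "modified delete_step = {IReg ''kept'', RArray ''starts'', RArray ''finishes''}"
  by (auto simp: delete_step_def)

lemma modified_delete_from_block [simp]: "modified delete_from_block =
    {IReg ''base'', IReg ''len'', IReg ''i'', IReg ''kept'', RArray ''starts'', RArray ''finishes'',
     IArray ''size''}"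
  by (auto simp: delete_from_block_def)

subsection \<open>Finding the block\<close>

definition block_of_start :: "nat \<Rightarrow> nat \<Rightarrow> real \<Rightarrow> memory \<Rightarrow> nat \<Rightarrow> bool" where
  "block_of_start W J x m b \<longleftrightarrow> (\<forall>i\<in>set (contents W b m). fst i < x) \<and>
     (\<forall>b'<J. b < b' \<longrightarrow> (\<forall>i\<in>set (block W m b'). x < fst i))"

lemma start_sorted_first_le: "start_sorted xs \<Longrightarrow> j \<in> set xs \<Longrightarrow> fst (xs ! 0) \<le> fst j"
  by (cases xs) (auto intro: less_imp_le)

lemma block_of_start_Suc:
  assumes sorted: "start_sorted (contents W (Suc k) m)" and t: "t \<le> k"
    and of_start: "block_of_start W k x m t"
    and t': "t' = (if 0 < iarr m ''size'' k \<and> rarr m ''starts'' (k * W) \<le> x then k else t)"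
  shows "block_of_start W (Suc k) x m t'"
proof (cases "0 < iarr m ''size'' k \<and> rarr m ''starts'' (k * W) \<le> x")
  case True
  then have "block W m k ! 0 \<in> set (block W m k)" by (intro nth_mem) simp
  then have "fst i < fst (block W m k ! 0)" if "i \<in> set (contents W k m)" for i
    using sorted that by (simp add: contents_Suc sorted_wrt_append)
  then have "fst i < x" if "i \<in> set (contents W k m)" for i
    using True that by (fastforce simp: nth_block)
  then show ?thesis using True t' by (auto simp: block_of_start_def)
next
  case False
  have "x < fst j" if j: "j \<in> set (block W m k)" for j
  proof -
    have "0 < iarr m ''size'' k" using length_pos_if_in_set[OF j] by simp
    moreover have "fst (block W m k ! 0) \<le> fst j"
      using start_sorted_first_le[OF start_sorted_block[OF sorted] j] by simp
    ultimately show ?thesis using False by (simp add: nth_block)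
  qed
  then show ?thesis using False t' of_start by (auto simp: block_of_start_def less_Suc_eq)
qed

lemma find_step_correct:
  assumes store: "block_store w J W m" and sorted: "start_sorted (contents W J m)"
    and k: "ivar m ''b'' = k" "k < J" and target: "ivar m ''target'' \<le> k"
    and of_start: "block_of_start W k (rvar m ''start'') m (ivar m ''target'')"
  shows "wp w find_step (\<lambda>m'. ivar m' ''target'' \<le> k \<and>
    block_of_start W (Suc k) (rvar m ''start'') m (ivar m' ''target'')) m"
proof -
  note [simp] = block_storeD(1,2)[OF store] k(1) and size = block_storeD(3)[OF store k(2)]
    and fits = block_storeD(4)[OF store]
  let ?t = "if 0 < iarr m ''size'' k \<and> rarr m ''starts'' (k * W) \<le> rvar m ''start''
    then k else ivar m ''target''"
  have "block_of_start W (Suc k) (rvar m ''start'') m ?t"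
    using k(2)
    by (intro block_of_start_Suc[OF start_sorted_contents_le[OF sorted] target of_start]) simp_all
  moreover have "k * W + W \<le> J * W" using k(2) mult_le_mono1[of "Suc k" J W] by simp
  ultimately show ?thesis
    using k(2) target size fits by (auto simp: find_step_def not_less split: if_splits)
qed

lemma find_block_correct:
  assumes store: "block_store w J W m" and sorted: "start_sorted (contents W J m)" and J: "0 < J"
  shows "exec_within w find_block m (J * 28 + 10)
    (\<lambda>m'. ivar m' ''b'' < J \<and> block_of_start W J (rvar m ''start'') m (ivar m' ''b''))"
  unfolding find_block_def
proof (rule exec_within_init[where T = "J * 28 + 8"], rule exec_within_Seq)
  note [simp] = block_storeD(1,2)[OF store] and fits = block_storeD(4)[OF store]
  let ?m = "m\<lparr>ivar := (ivar m)(''target'' := 0)\<rparr>"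
  let ?I = "\<lambda>k m'. ivar m' ''target'' < J \<and> ivar m' ''target'' \<le> k \<and>
    block_of_start W k (rvar m ''start'') m (ivar m' ''target'')"
  show "exec_within w (FOR ''b'' < ''blocks'' DO find_step) ?m (J * 28 + 6) (?I J)"
  proof (rule exec_within_For[where I = ?I and n = J and C = "cost find_step"])
    show "?I 0 (?m\<lparr>ivar := (ivar ?m)(''b'' := 0)\<rparr>)" using J by (simp add: block_of_start_def)
    fix k m'
    assume k: "k < J" "ivar m' ''b'' = k" and inv: "?I k m'"
      and "agree_outside (insert (IReg ''b'') (modified find_step)) ?m m'"
    note [simp] = agree_outsideD[OF this(4)]
    have [simp]: "block W m' = block W m" by (simp add: block_def fun_eq_iff)
    have "block_store w J W m'" using store by (simp add: block_store_def)
    then have "wp w find_step (\<lambda>m''. ivar m'' ''target'' \<le> k \<and>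
        block_of_start W (Suc k) (rvar m ''start'') m (ivar m'' ''target'')) m'"
      using find_step_correct[of w J W m' k] sorted k inv
      by (simp add: block_of_start_def contents_def)
    then show "exec_within w find_step m' (cost find_step)
        (\<lambda>m''. ?I (Suc k) (m''\<lparr>ivar := (ivar m'')(''b'' := Suc k)\<rparr>))"
      by (rule exec_within_weaken[OF exec_within_cost]) (use k in simp_all)
  qed (use fits in \<open>simp_all add: find_step_def\<close>)
  show "exec_within w (''b'' ::= \<acute>''target'') m1 2
      (\<lambda>m'. ivar m' ''b'' < J \<and> block_of_start W J (rvar m ''start'') m (ivar m' ''b''))"
    if "?I J m1" for m1
    using that fits by (intro exec_within_wp) auto
qed simp_all

subsection \<open>Inserting\<close>

lemma insort_key_snoc:
  assumes "insort_key f x xs = ys @ [z]" and "sorted (map f (xs @ [y]))"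
  shows "insort_key f x (xs @ [y]) = ys @ (if f y < f z then [y, z] else [z, y])"
  using assms
proof (induction xs arbitrary: ys)
  case (Cons a xs)
  show ?case
  proof (cases "f x \<le> f a")
    case True
    then have "x # a # xs = ys @ [z]" using Cons.prems by simp
    moreover from this have "z \<in> set (a # xs)"
      by (metis last_ConsR last_in_set last_snoc list.discI)
    then have "\<not> f y < f z" using Cons.prems(2) by (auto simp: sorted_append not_less)
    ultimately show ?thesis using True by simp
  next
    case False
    then have "a # insort_key f x xs = ys @ [z]" using Cons.prems by simp
    then obtain ys' where ys: "ys = a # ys'" "insort_key f x xs = ys' @ [z]"
      by (cases ys) (auto dest: arg_cong[where f = set])
    then show ?thesis using False Cons.IH[OF ys(2)] Cons.prems(2) by simp
  qed
qed auto

lemma sorted_map_start_sorted: "start_sorted xs \<Longrightarrow> sorted (map fst xs)"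
  unfolding sorted_map by (rule sorted_wrt_mono_rel) simp_all

definition same_cells_from :: "nat \<Rightarrow> memory \<Rightarrow> memory \<Rightarrow> bool" where
  "same_cells_from n m m' \<longleftrightarrow> (\<forall>j\<ge>n. rarr m' ''starts'' j = rarr m ''starts'' j \<and>
     rarr m' ''finishes'' j = rarr m ''finishes'' j)"

definition passed_interval :: "memory \<Rightarrow> interval" where
  "passed_interval m = (rvar m ''start'', rvar m ''finish'')"

lemma passed_interval_ivar [simp]: "passed_interval (m\<lparr>ivar := v\<rparr>) = passed_interval m"
  by (simp add: passed_interval_def)

definition partial_insert :: "nat \<Rightarrow> nat \<Rightarrow> memory \<Rightarrow> nat \<Rightarrow> memory \<Rightarrow> bool" where
  "partial_insert W b m k m' \<longleftrightarrow>
     segment (rarr m' ''starts'') (rarr m' ''finishes'') (b * W) k @ [passed_interval m'] =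
       insort_key fst (passed_interval m) (take k (block W m b)) \<and>
     same_cells_from (b * W + k) m m' \<and> same_other_blocks W b m m'"

lemma partial_insert_ivar [simp]:
  "partial_insert W b m k (m'\<lparr>ivar := v\<rparr>) \<longleftrightarrow> partial_insert W b m k m'"
  by (simp add: partial_insert_def same_cells_from_def same_other_blocks_def same_block_def)

lemma insert_step_correct:
  assumes loaded: "block_loaded w W b m'" and size: "iarr m' ''size'' b = iarr m ''size'' b"
    and sorted: "start_sorted (block W m b)"
    and k: "k < iarr m ''size'' b" "ivar m' ''i'' = k" and partial: "partial_insert W b m k m'"
  shows "wp w insert_step (partial_insert W b m (Suc k)) m'"
proof -
  note [simp] = block_loadedD(1-4)[OF loaded] k(2) and fits = block_loadedD(5,6)[OF loaded]
  let ?S = "rarr m' ''starts''" and ?F = "rarr m' ''finishes''"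
  have xs: "take (Suc k) (block W m b) = take k (block W m b) @ [(?S (b * W + k), ?F (b * W + k))]"
    using k partial
    by (simp add: take_Suc_conv_app_nth nth_block partial_insert_def same_cells_from_def)
  have sorted': "sorted (map fst (take (Suc k) (block W m b)))"
    using sorted_wrt_take[OF sorted] by (rule sorted_map_start_sorted)
  have "insort_key fst (passed_interval m) (take k (block W m b)) =
      segment ?S ?F (b * W) k @ [passed_interval m']"
    using partial by (simp add: partial_insert_def)
  then have insort: "insort_key fst (passed_interval m) (take (Suc k) (block W m b)) =
      segment ?S ?F (b * W) k @ (if ?S (b * W + k) < rvar m' ''start''
        then [(?S (b * W + k), ?F (b * W + k)), passed_interval m']
        else [passed_interval m', (?S (b * W + k), ?F (b * W + k))])"
    using insort_key_snoc[OF _ sorted'[unfolded xs]] unfolding xs by (simp add: passed_interval_def)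
  have other: "b' * W + i \<noteq> b * W + k" if "b' \<noteq> b" "i < W" for b' i
    using block_index_eq_iff[of i W k b' b] that k size fits by simp
  show ?thesis
    using partial insort other k size fits
    by (auto simp: insert_step_def partial_insert_def passed_interval_def same_cells_from_def
      same_other_blocks_def same_block_def segment_Suc)
qed

lemma insert_loop_correct:
  assumes loaded: "block_loaded w W b m" and sorted: "start_sorted (block W m b)"
  shows "exec_within w (FOR ''i'' < ''len'' DO insert_step) m (W * 50 + 6)
    (partial_insert W b m (iarr m ''size'' b))"
proof (rule exec_within_For[where n = "iarr m ''size'' b" and C = 40 and
      I = "partial_insert W b m"])
  note [simp] = block_loadedD(1-4)[OF loaded] and fits = block_loadedD(5,6)[OF loaded]
  show "partial_insert W b m 0 (m\<lparr>ivar := (ivar m)(''i'' := 0)\<rparr>)"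
    by (simp add: partial_insert_def passed_interval_def same_cells_from_def same_other_blocks_def
        same_block_def)
  show "ivar m ''len'' = iarr m ''size'' b" "iarr m ''size'' b < 2 ^ w"
    "iarr m ''size'' b * (40 + 8) + 6 \<le> W * 50 + 6"
    using fits by simp_all
  fix k m'
  assume k: "k < iarr m ''size'' b" "ivar m' ''i'' = k" and partial: "partial_insert W b m k m'"
    and "agree_outside (insert (IReg ''i'') (modified insert_step)) m m'"
  note [simp] = agree_outsideD[OF this(4)]
  have "wp w insert_step (partial_insert W b m (Suc k)) m'"
    using loaded k partial sorted
    by (intro insert_step_correct) (auto simp: block_loaded_def block_selected_def)
  then show "exec_within w insert_step m' 40
      (\<lambda>m''. partial_insert W b m (Suc k) (m''\<lparr>ivar := (ivar m'')(''i'' := Suc k)\<rparr>))"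
    by (rule exec_within_weaken[OF exec_within_cost]) (simp_all add: insert_step_def)
qed simp_all

lemma insert_into_block_correct:
  assumes selected: "block_selected w W b m" and sorted: "start_sorted (block W m b)"
    and room: "iarr m ''size'' b < W"
  shows "exec_within w insert_into_block m (W * 50 + 30)
    (\<lambda>m'. block W m' b = insort_key fst (passed_interval m) (block W m b) \<and>
       same_other_blocks W b m m')"
  unfolding insert_into_block_def
proof (rule exec_within_select_block[where T = "W * 50 + 23", OF selected], rule exec_within_Seq)
  fix m1
  assume loaded: "block_loaded w W b m1"
    and agree: "agree_outside {IReg ''base'', IReg ''len''} m m1"
  note [simp] = block_loadedD(1-4)[OF loaded] agree_outsideD[OF agree]
    and fits = block_loadedD(5,6)[OF loaded]
  have [simp]: "block W m1 b = block W m b" "passed_interval m1 = passed_interval m"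
    by (simp_all add: block_def passed_interval_def)
  show "exec_within w (FOR ''i'' < ''len'' DO insert_step) m1 (W * 50 + 6)
      (partial_insert W b m1 (iarr m1 ''size'' b))"
    using insert_loop_correct[OF loaded] sorted by simp
  fix m2
  assume "agree_outside (modified (FOR ''i'' < ''len'' DO insert_step)) m1 m2"
    and partial: "partial_insert W b m1 (iarr m1 ''size'' b) m2"
  note [simp] = agree_outsideD[OF this(1)]
  have "b' * W + i \<noteq> b * W + iarr m ''size'' b" if "b' \<noteq> b" "i < W" for b' i
    using block_index_eq_iff[of i W "iarr m ''size'' b" b' b] that room by simp
  then show "exec_within w append_interval m2 17
      (\<lambda>m'. block W m' b = insort_key fst (passed_interval m) (block W m b) \<and>
         same_other_blocks W b m m')"
    using partial fits room by (intro exec_within_wp)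
      (auto simp: append_interval_def partial_insert_def passed_interval_def same_other_blocks_def
        same_block_def block_def segment_Suc)
qed simp_all

subsection \<open>Deleting\<close>

definition partial_delete :: "nat \<Rightarrow> nat \<Rightarrow> memory \<Rightarrow> nat \<Rightarrow> memory \<Rightarrow> bool" where
  "partial_delete W b m k m' \<longleftrightarrow> ivar m' ''kept'' \<le> k \<and>
     segment (rarr m' ''starts'') (rarr m' ''finishes'') (b * W) (ivar m' ''kept'') =
       filter (\<lambda>i. fst i \<noteq> rvar m ''start'') (take k (block W m b)) \<and>
     same_cells_from (b * W + k) m m' \<and> same_other_blocks W b m m'"

lemma partial_delete_ivar [simp]: "x \<noteq> ''kept'' \<Longrightarrow>
  partial_delete W b m k (m'\<lparr>ivar := (ivar m')(x := v)\<rparr>) \<longleftrightarrow> partial_delete W b m k m'"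
  by (simp add: partial_delete_def same_cells_from_def same_other_blocks_def same_block_def)

lemma delete_step_correct:
  assumes loaded: "block_loaded w W b m'" and same: "iarr m' ''size'' b = iarr m ''size'' b"
      "rvar m' ''start'' = rvar m ''start''"
    and k: "k < iarr m ''size'' b" "ivar m' ''i'' = k" and partial: "partial_delete W b m k m'"
  shows "wp w delete_step (partial_delete W b m (Suc k)) m'"
proof -
  note [simp] = block_loadedD(1-4)[OF loaded] k(2) and fits = block_loadedD(5,6)[OF loaded]
  let ?S = "rarr m' ''starts''" and ?F = "rarr m' ''finishes''" and ?l = "ivar m' ''kept''"
  have xs: "take (Suc k) (block W m b) = take k (block W m b) @ [(?S (b * W + k), ?F (b * W + k))]"
    using k partial
    by (simp add: take_Suc_conv_app_nth nth_block partial_delete_def same_cells_from_def)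
  have l: "?l \<le> k" using partial by (simp add: partial_delete_def)
  have other: "b' * W + i \<noteq> b * W + ?l" if "b' \<noteq> b" "i < W" for b' i
    using block_index_eq_iff[of i W ?l b' b] that k l same fits by simp
  show ?thesis
    using partial other k l same fits
    by (auto simp: delete_step_def partial_delete_def same_cells_from_def same_other_blocks_def
      same_block_def segment_Suc xs)
qed

lemma delete_loop_correct:
  assumes loaded: "block_loaded w W b m" and kept: "ivar m ''kept'' = 0"
  shows "exec_within w (FOR ''i'' < ''len'' DO delete_step) m (W * 50 + 6)
    (partial_delete W b m (iarr m ''size'' b))"
proof (rule exec_within_For[where n = "iarr m ''size'' b" and C = 40 and
      I = "partial_delete W b m"])
  note [simp] = block_loadedD(1-4)[OF loaded] and fits = block_loadedD(5,6)[OF loaded]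
  show "partial_delete W b m 0 (m\<lparr>ivar := (ivar m)(''i'' := 0)\<rparr>)"
    using kept
    by (simp add: partial_delete_def same_cells_from_def same_other_blocks_def same_block_def)
  show "ivar m ''len'' = iarr m ''size'' b" "iarr m ''size'' b < 2 ^ w"
    "iarr m ''size'' b * (40 + 8) + 6 \<le> W * 50 + 6"
    using fits by simp_all
  fix k m'
  assume k: "k < iarr m ''size'' b" "ivar m' ''i'' = k" and partial: "partial_delete W b m k m'"
    and "agree_outside (insert (IReg ''i'') (modified delete_step)) m m'"
  note [simp] = agree_outsideD[OF this(4)]
  have "wp w delete_step (partial_delete W b m (Suc k)) m'"
    using loaded k partial
    by (intro delete_step_correct) (auto simp: block_loaded_def block_selected_def)
  then show "exec_within w delete_step m' 40
      (\<lambda>m''. partial_delete W b m (Suc k) (m''\<lparr>ivar := (ivar m'')(''i'' := Suc k)\<rparr>))"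
    by (rule exec_within_weaken[OF exec_within_cost]) (simp_all add: delete_step_def)
qed simp_all

lemma delete_from_block_correct:
  assumes selected: "block_selected w W b m"
  shows "exec_within w delete_from_block m (W * 50 + 30)
    (\<lambda>m'. block W m' b = filter (\<lambda>i. fst i \<noteq> rvar m ''start'') (block W m b) \<and>
       same_other_blocks W b m m')"
  unfolding delete_from_block_def
proof (rule exec_within_select_block[where T = "W * 50 + 11", OF selected],
    rule exec_within_init[where T = "W * 50 + 9"], rule exec_within_Seq)
  fix m1
  assume loaded: "block_loaded w W b m1"
    and agree: "agree_outside {IReg ''base'', IReg ''len''} m m1"
  note [simp] = block_loadedD(1-4)[OF loaded] agree_outsideD[OF agree]
    and fits = block_loadedD(5,6)[OF loaded]
  let ?m = "m1\<lparr>ivar := (ivar m1)(''kept'' := 0)\<rparr>"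
  have [simp]: "block W m1 b = block W m b" by (simp add: block_def)
  show "exec_within w (FOR ''i'' < ''len'' DO delete_step) ?m (W * 50 + 6)
      (partial_delete W b ?m (iarr m1 ''size'' b))"
    using delete_loop_correct[of w W b ?m] loaded by (simp add: block_loaded_def block_selected_def)
  fix m2
  assume "agree_outside (modified (FOR ''i'' < ''len'' DO delete_step)) ?m m2"
    and partial: "partial_delete W b ?m (iarr m1 ''size'' b) m2"
  note [simp] = agree_outsideD[OF this(1)]
  show "exec_within w (''size''\<lbrakk>\<acute>''b''\<rbrakk> ::= \<acute>''kept'') m2 3
      (\<lambda>m'. block W m' b = filter (\<lambda>i. fst i \<noteq> rvar m ''start'') (block W m b) \<and>
         same_other_blocks W b m m')"
    using partial fits by (intro exec_within_wp)
      (auto simp: partial_delete_def same_other_blocks_def same_block_def block_def)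
qed simp_all

section \<open>Rebuilding all blocks\<close>

definition append_step :: com where
  "append_step =
     ''all_starts''\<lbrakk>\<acute>''total''\<rbrakk> ::=\<^sub>r ''starts''\<lbrakk>cell \<acute>''i''\<rbrakk>\<^sub>r ;;
     ''all_finishes''\<lbrakk>\<acute>''total''\<rbrakk> ::=\<^sub>r ''finishes''\<lbrakk>cell \<acute>''i''\<rbrakk>\<^sub>r ;;
     ''total'' ::= \<acute>''total'' \<oplus> Num 1"

definition append_block :: com where
  "append_block = select_block ;; FOR ''i'' < ''len'' DO append_step"

definition flatten :: com where
  "flatten = ''total'' ::= Num 0 ;; FOR ''b'' < ''blocks'' DO append_block"

definition fill_init :: com where
  "fill_init =
     ''base'' ::= \<acute>''b'' \<otimes> \<acute>''capacity'' ;;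
     (IF \<acute>''next'' \<oplus> \<acute>''blocks'' <\<^sub>i \<acute>''total''
      THEN ''len'' ::= \<acute>''blocks''
      ELSE ''len'' ::= \<acute>''total'' \<ominus> \<acute>''next'') ;;
     ''size''\<lbrakk>\<acute>''b''\<rbrakk> ::= \<acute>''len''"

definition fill_step :: com where
  "fill_step =
     ''starts''\<lbrakk>cell \<acute>''i''\<rbrakk> ::=\<^sub>r ''all_starts''\<lbrakk>\<acute>''next''\<rbrakk>\<^sub>r ;;
     ''finishes''\<lbrakk>cell \<acute>''i''\<rbrakk> ::=\<^sub>r ''all_finishes''\<lbrakk>\<acute>''next''\<rbrakk>\<^sub>r ;;
     ''next'' ::= \<acute>''next'' \<oplus> Num 1"

definition fill_block :: com where
  "fill_block = fill_init ;; FOR ''i'' < ''len'' DO fill_step"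

definition distribute :: com where
  "distribute = ''next'' ::= Num 0 ;; FOR ''b'' < ''blocks'' DO fill_block"

definition build_tables :: com where
  "build_tables = FOR ''b'' < ''blocks'' DO build_table"

definition rebuild :: com where
  "rebuild =
     flatten ;;
     (''blocks'' ::= \<acute>''blocks'' \<oplus> Num 1 ;;
      ''capacity'' ::= Num 2 \<otimes> \<acute>''blocks'' ;;
      ''updates'' ::= Num 0) ;;
     distribute ;;
     build_tables"

lemma modified_append_step [simp]:
  "modified append_step = {IReg ''total'', RArray ''all_starts'', RArray ''all_finishes''}"
  by (auto simp: append_step_def)

lemma modified_append_block [simp]: "modified append_block = {IReg ''base'', IReg ''len'',
    IReg ''i'', IReg ''total'', RArray ''all_starts'', RArray ''all_finishes''}"
  by (auto simp: append_block_def)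

lemma modified_flatten [simp]: "modified flatten = {IReg ''b'', IReg ''base'', IReg ''len'',
    IReg ''i'', IReg ''total'', RArray ''all_starts'', RArray ''all_finishes''}"
  by (auto simp: flatten_def)

lemma modified_fill_step [simp]:
  "modified fill_step = {IReg ''next'', RArray ''starts'', RArray ''finishes''}"
  by (auto simp: fill_step_def)

lemma modified_fill_block [simp]: "modified fill_block = {IReg ''base'', IReg ''len'', IReg ''i'',
    IReg ''next'', IArray ''size'', RArray ''starts'', RArray ''finishes''}"
  by (auto simp: fill_block_def fill_init_def)

lemma modified_distribute [simp]: "modified distribute = {IReg ''b'', IReg ''base'', IReg ''len'',
    IReg ''i'', IReg ''next'', IArray ''size'', RArray ''starts'', RArray ''finishes''}"
  by (auto simp: distribute_def)

lemma modified_build_tables [simp]: "modified build_tables = {IReg ''b'', IReg ''base'',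
    IReg ''len'', IReg ''p'', IReg ''q'', IArray ''gain'', IArray ''prefix'', RArray ''ends''}"
  by (auto simp: build_tables_def)

lemma modified_rebuild [simp]: "modified rebuild =
    {IReg ''blocks'', IReg ''capacity'', IReg ''updates'', IReg ''b'', IReg ''base'', IReg ''len'',
     IReg ''i'', IReg ''total'', IReg ''next'', IReg ''p'', IReg ''q'', IArray ''size'',
     IArray ''gain'', IArray ''prefix'', RArray ''starts'', RArray ''finishes'',
     RArray ''all_starts'', RArray ''all_finishes'', RArray ''ends''}"
  by (auto simp: rebuild_def)

definition flat_list :: "memory \<Rightarrow> interval list" where
  "flat_list m = segment (rarr m ''all_starts'') (rarr m ''all_finishes'') 0 (ivar m ''total'')"

lemma length_flat_list [simp]: "length (flat_list m) = ivar m ''total''"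
  by (simp add: flat_list_def)

lemma flat_list_ivar [simp]:
  "x \<noteq> ''total'' \<Longrightarrow> flat_list (m\<lparr>ivar := (ivar m)(x := v)\<rparr>) = flat_list m"
  by (simp add: flat_list_def)

lemma append_block_correct:
  assumes selected: "block_selected w W b m"
    and fits: "ivar m ''total'' + iarr m ''size'' b < 2 ^ w"
  shows "exec_within w append_block m (W * 30 + 20)
    (\<lambda>m'. flat_list m' = flat_list m @ block W m b)"
  unfolding append_block_def
proof (rule exec_within_select_block[OF selected])
  fix m1
  assume loaded: "block_loaded w W b m1" and "agree_outside {IReg ''base'', IReg ''len''} m m1"
  note [simp] = block_loadedD(1-4)[OF loaded] agree_outsideD[OF this(2)]
    and index_fits = block_loadedD(5,6)[OF loaded]
  let ?n = "iarr m ''size'' b"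
  let ?I = "\<lambda>k m'. ivar m' ''total'' = ivar m ''total'' + k \<and>
    flat_list m' = flat_list m @ take k (block W m b)"
  show "exec_within w (FOR ''i'' < ''len'' DO append_step) m1 (W * 30 + 6)
    (\<lambda>m'. flat_list m' = flat_list m @ block W m b)"
  proof (rule exec_within_For[where n = ?n and C = 22 and I = ?I])
    show "?I 0 (m1\<lparr>ivar := (ivar m1)(''i'' := 0)\<rparr>)" by (simp add: flat_list_def)
    fix k m'
    assume k: "k < ?n" "ivar m' ''i'' = k" and inv: "?I k m'"
      and "agree_outside (insert (IReg ''i'') (modified append_step)) m1 m'"
    note [simp] = agree_outsideD[OF this(4)] k(2)
    show "exec_within w append_step m' 22
        (\<lambda>m''. ?I (Suc k) (m''\<lparr>ivar := (ivar m'')(''i'' := Suc k)\<rparr>))"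
      using inv k index_fits fits
      by (intro exec_within_wp)
        (auto simp: append_step_def flat_list_def segment_Suc take_Suc_conv_app_nth nth_block)
  qed (use index_fits in simp_all)
qed simp

lemma flatten_correct:
  assumes store: "block_store w J W m"
  shows "exec_within w flatten m (J * (W * 30 + 28) + 8) (\<lambda>m'. flat_list m' = contents W J m)"
  unfolding flatten_def
proof (rule exec_within_init[where T = "J * (W * 30 + 28) + 6"],
    rule exec_within_For[where n = J and C = "W * 30 + 20" and
      I = "\<lambda>k m'. flat_list m' = contents W k m"])
  note [simp] = block_storeD(1,2)[OF store] and sizes = block_storeD(3)[OF store]
    and fits = block_storeD(4)[OF store]
  let ?m = "m\<lparr>ivar := (ivar m)(''total'' := 0)\<rparr>"
  show "flat_list (?m\<lparr>ivar := (ivar ?m)(''b'' := 0)\<rparr>) = contents W 0 m"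
    by (simp add: flat_list_def)
  show "ivar ?m ''blocks'' = J" "J < 2 ^ w" using fits by simp_all
  fix k m'
  assume k: "k < J" "ivar m' ''b'' = k" and flat: "flat_list m' = contents W k m"
    and "agree_outside (insert (IReg ''b'') (modified append_block)) ?m m'"
  note [simp] = agree_outsideD[OF this(4)]
  have "ivar m' ''total'' = length (contents W k m)" by (simp flip: flat)
  also have "\<dots> \<le> k * W" using sizes k by (intro length_contents_le) auto
  finally have "ivar m' ''total'' \<le> k * W" .
  moreover have "Suc k * W \<le> J * W" using k by (intro mult_le_mono1) simp
  ultimately have "ivar m' ''total'' + iarr m ''size'' k < 2 ^ w"
    using sizes[OF k(1)] fits by simp
  then have "exec_within w append_block m' (W * 30 + 20)
      (\<lambda>m''. flat_list m'' = flat_list m' @ block W m' k)"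
    using store k by (intro append_block_correct block_store_selected[where J = J])
      (simp_all add: block_store_def)
  moreover have "block W m' k = block W m k" by (simp add: block_def)
  ultimately show "exec_within w append_block m' (W * 30 + 20)
      (\<lambda>m''. flat_list (m''\<lparr>ivar := (ivar m'')(''b'' := Suc k)\<rparr>) = contents W (Suc k) m)"
    by (simp add: flat contents_Suc)
qed simp_all

lemma fill_loop_correct:
  assumes regs: "ivar m ''base'' = b * W" "ivar m ''len'' = l" "ivar m ''next'' = p"
    and l: "l \<le> J" "J \<le> W" "p + l \<le> ivar m ''total''"
    and fits: "b * W + W < 2 ^ w" "ivar m ''total'' < 2 ^ w"
  shows "exec_within w (FOR ''i'' < ''len'' DO fill_step) m (J * 30 + 6)
    (\<lambda>m'. ivar m' ''next'' = p + l \<and> same_other_blocks W b m m' \<and>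
       segment (rarr m' ''starts'') (rarr m' ''finishes'') (b * W) l =
         take l (drop p (flat_list m)))"
proof -
  let ?xs = "drop p (flat_list m)"
  let ?I = "\<lambda>k m'. ivar m' ''next'' = p + k \<and> same_other_blocks W b m m' \<and>
    segment (rarr m' ''starts'') (rarr m' ''finishes'') (b * W) k = take k ?xs"
  show "exec_within w (FOR ''i'' < ''len'' DO fill_step) m (J * 30 + 6) (?I l)"
  proof (rule exec_within_For[where n = l and C = 22 and I = ?I])
    show "?I 0 (m\<lparr>ivar := (ivar m)(''i'' := 0)\<rparr>)"
      using regs by (simp add: same_other_blocks_def same_block_def)
    fix k m'
    assume k: "k < l" "ivar m' ''i'' = k" and inv: "?I k m'"
      and "agree_outside (insert (IReg ''i'') (modified fill_step)) m m'"
    note [simp] = agree_outsideD[OF this(4)] regs k(2)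
    have "take (Suc k) ?xs =
        take k ?xs @ [(rarr m ''all_starts'' (p + k), rarr m ''all_finishes'' (p + k))]"
      using k l by (simp add: take_Suc_conv_app_nth flat_list_def)
    moreover have "b' * W + i \<noteq> b * W + k" if "b' \<noteq> b" "i < W" for b' i
      using block_index_eq_iff[of i W k b' b] that k l by simp
    ultimately show "exec_within w fill_step m' 22
        (\<lambda>m''. ?I (Suc k) (m''\<lparr>ivar := (ivar m'')(''i'' := Suc k)\<rparr>))"
      using inv k l fits by (intro exec_within_wp)
        (auto simp: fill_step_def segment_Suc same_other_blocks_def same_block_def)
  qed (use regs l fits in simp_all)
qed

lemma fill_block_correct:
  assumes regs: "ivar m ''b'' = b" "ivar m ''capacity'' = W" "ivar m ''blocks'' = J" "J \<le> W"
    and p: "ivar m ''next'' = p" "p \<le> ivar m ''total''"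
    and fits: "b * W + W < 2 ^ w" "b < 2 ^ w" "ivar m ''total'' + J < 2 ^ w"
  shows "exec_within w fill_block m (J * 30 + 40)
    (\<lambda>m'. ivar m' ''next'' = min (p + J) (ivar m ''total'') \<and>
       block W m' b = take J (drop p (flat_list m)) \<and> same_other_blocks W b m m')"
  unfolding fill_block_def
proof (rule exec_within_Seq)
  define l where "l = min J (ivar m ''total'' - p)"
  then have l: "l \<le> J" "p + l = min (p + J) (ivar m ''total'')" "p + l \<le> ivar m ''total''"
    using p(2) by auto
  let ?m = "m\<lparr>ivar := (ivar m)(''base'' := b * W, ''len'' := l),
    iarr := (iarr m)(''size'' := (iarr m ''size'')(b := l))\<rparr>"
  consider "p + J < ivar m ''total''" "l = J" |
    "\<not> p + J < ivar m ''total''" "l = ivar m ''total'' - p"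
    by (cases "p + J < ivar m ''total''") (simp_all add: l_def)
  then have "wp w fill_init (\<lambda>m1. m1 = ?m) m"
    by cases (use regs p fits in \<open>simp_all add: fill_init_def\<close>)
  then show "exec_within w fill_init m (cost fill_init) (\<lambda>m1. m1 = ?m)" by (rule exec_within_cost)
  fix m1 assume m1: "m1 = ?m"
  have flat: "flat_list m1 = flat_list m" by (simp add: m1 flat_list_def)
  have "take l (drop p (flat_list m)) = take J (drop p (flat_list m))" by (simp add: l_def min_def)
  moreover have "exec_within w (FOR ''i'' < ''len'' DO fill_step) m1 (J * 30 + 6)
    (\<lambda>m'. ivar m' ''next'' = p + l \<and> same_other_blocks W b m1 m' \<and>
       segment (rarr m' ''starts'') (rarr m' ''finishes'') (b * W) l =
         take l (drop p (flat_list m1)))"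
    using regs(4) p fits l by (intro fill_loop_correct) (simp_all add: m1)
  ultimately show "exec_within w (FOR ''i'' < ''len'' DO fill_step) m1 (J * 30 + 6)
    (\<lambda>m'. ivar m' ''next'' = min (p + J) (ivar m ''total'') \<and>
       block W m' b = take J (drop p (flat_list m)) \<and> same_other_blocks W b m m')"
    unfolding flat l(2)
    by (elim exec_within_weaken)
      (auto simp: m1 block_def same_other_blocks_def same_block_def agree_outsideD)
qed (simp add: fill_init_def)

definition distributed :: "nat \<Rightarrow> nat \<Rightarrow> interval list \<Rightarrow> nat \<Rightarrow> memory \<Rightarrow> bool" where
  "distributed W J xs k m \<longleftrightarrow> ivar m ''next'' = min (k * J) (length xs) \<and>
     contents W k m = take (k * J) xs \<and> (\<forall>b<k. iarr m ''size'' b \<le> J)"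

lemma distributed_Suc:
  assumes distributed: "distributed W J xs k m" and "J \<le> W"
    and "ivar m' ''next'' = min (ivar m ''next'' + J) (length xs)"
    and block: "block W m' k = take J (drop (ivar m ''next'') xs)"
    and same: "same_other_blocks W k m m'"
  shows "distributed W J xs (Suc k) m'"
proof -
  have same: "same_block W m m' b" if "b < k" for b
    using same that by (simp add: same_other_blocks_def)
  have "contents W k m' = contents W k m"
    using distributed same \<open>J \<le> W\<close>
    by (intro contents_cong block_same_block) (auto simp: distributed_def intro: order_trans)
  moreover have "block W m' k = take J (drop (k * J) xs)"
    using block distributed by (cases "k * J \<le> length xs") (simp_all add: distributed_def)
  ultimately have "contents W (Suc k) m' = take (k * J) xs @ take J (drop (k * J) xs)"
    using distributed by (simp add: contents_Suc distributed_def)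
  then have "contents W (Suc k) m' = take (Suc k * J) xs" by (simp add: take_add add.commute[of J])
  moreover have "iarr m' ''size'' b \<le> J" if "b < Suc k" for b
  proof (cases "b = k")
    case True
    have "iarr m' ''size'' k = length (block W m' k)" by simp
    also have "\<dots> \<le> J" unfolding block by simp
    finally show ?thesis using True by simp
  next
    case False
    then show ?thesis using same[of b] distributed that
      by (simp add: distributed_def same_block_def)
  qed
  ultimately show ?thesis using assms(3) distributed by (auto simp: distributed_def min_def)
qed

lemma distribute_correct:
  assumes regs: "ivar m ''capacity'' = W" "ivar m ''blocks'' = J" "J \<le> W"
    and total: "ivar m ''total'' \<le> J * J" and fits: "(J + 2) * (W + 1) < 2 ^ w"
  shows "exec_within w distribute m (J * (J * 30 + 48) + 8)
    (\<lambda>m'. contents W J m' = flat_list m \<and> (\<forall>b<J. iarr m' ''size'' b \<le> J))"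
  unfolding distribute_def
proof (rule exec_within_init[where T = "J * (J * 30 + 48) + 6"],
    rule exec_within_For[where n = J and C = "J * 30 + 40" and I = "distributed W J (flat_list m)"])
  note [simp] = regs(1,2)
  have fits: "J * W + J + 2 * W + 2 < 2 ^ w" using fits by simp
  have "J * J \<le> J * W" using regs(3) by simp
  then have total_fits: "ivar m ''total'' + J < 2 ^ w" using total fits by linarith
  let ?m = "m\<lparr>ivar := (ivar m)(''next'' := 0)\<rparr>"
  show "ivar ?m ''blocks'' = J" "J < 2 ^ w" using fits by simp_all
  show "distributed W J (flat_list m) 0 (?m\<lparr>ivar := (ivar ?m)(''b'' := 0)\<rparr>)"
    by (simp add: distributed_def)
  show "contents W J m' = flat_list m \<and> (\<forall>b<J. iarr m' ''size'' b \<le> J)"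
    if "distributed W J (flat_list m) J m'" for m'
    using that total by (simp add: distributed_def)
  fix k m'
  assume k: "k < J" "ivar m' ''b'' = k" and inv: "distributed W J (flat_list m) k m'"
    and "agree_outside (insert (IReg ''b'') (modified fill_block)) ?m m'"
  note [simp] = agree_outsideD[OF this(4)]
  have [simp]: "flat_list m' = flat_list m" by (simp add: flat_list_def)
  have "Suc k * W \<le> J * W" using k by (intro mult_le_mono1) simp
  then have "exec_within w fill_block m' (J * 30 + 40)
      (\<lambda>m''. ivar m'' ''next'' = min (ivar m' ''next'' + J) (ivar m' ''total'') \<and>
         block W m'' k = take J (drop (ivar m' ''next'') (flat_list m')) \<and>
         same_other_blocks W k m' m'')"
    using inv k fits total_fits regs(3)
    by (intro fill_block_correct) (simp_all add: distributed_def)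
  then show "exec_within w fill_block m' (J * 30 + 40) (\<lambda>m''.
      distributed W J (flat_list m) (Suc k) (m''\<lparr>ivar := (ivar m'')(''b'' := Suc k)\<rparr>))"
    by (rule exec_within_weaken)
      (use inv regs(3) in \<open>auto intro!: distributed_Suc[of W J _ k m'] simp: same_other_blocks_def
        same_block_def\<close>)
qed simp_all

lemma build_tables_correct:
  assumes store: "block_store w J W m" and sorted: "start_sorted (contents W J m)"
  shows "exec_within w build_tables m (J * (132 * W + 28) + 6) (\<lambda>m'. \<forall>b<J. has_table W m' b)"
  unfolding build_tables_def
proof (rule exec_within_For[where n = J and C = "132 * W + 20" and
      I = "\<lambda>k m'. \<forall>b<k. has_table W m' b"])
  note [simp] = block_storeD(1,2)[OF store] and sizes = block_storeD(3)[OF store]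
    and fits = block_storeD(4)[OF store]
  show "ivar m ''blocks'' = J" "J < 2 ^ w" using fits by simp_all
  fix k m'
  assume k: "k < J" "ivar m' ''b'' = k" and tables: "\<forall>b<k. has_table W m' b"
    and "agree_outside (insert (IReg ''b'') (modified build_table)) m m'"
  note [simp] = agree_outsideD[OF this(4)]
  have [simp]: "block W m' k = block W m k" by (simp add: block_def)
  have "block_store w J W m'" using store by (simp add: block_store_def)
  then have "exec_within w build_table m' (132 * W + 20)
      (\<lambda>m''. has_table W m'' k \<and> same_other_blocks W k m' m'')"
    using k start_sorted_block[OF sorted k(1)]
    by (intro build_table_correct block_store_selected) simp_all
  then show "exec_within w build_table m' (132 * W + 20)
      (\<lambda>m''. \<forall>b<Suc k. has_table W (m''\<lparr>ivar := (ivar m'')(''b'' := Suc k)\<rparr>) b)"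
  proof (rule exec_within_weaken)
    fix m''
    assume built: "has_table W m'' k \<and> same_other_blocks W k m' m''"
    have "has_table W m'' b" if "b < Suc k" for b
      using built tables k sizes[of b] that has_table_same_block[of W m' m'' b]
      by (cases "b = k") (auto simp: same_other_blocks_def)
    then show "\<forall>b<Suc k. has_table W (m''\<lparr>ivar := (ivar m'')(''b'' := Suc k)\<rparr>) b"
      by simp
  qed simp
qed simp_all

text \<open>The words can address the \<open>J + 1\<close> blocks of capacity \<open>2 * (J + 1)\<close> of phase \<open>J + 1\<close>.\<close>

definition next_phase_fits :: "nat \<Rightarrow> nat \<Rightarrow> bool" where
  "next_phase_fits w J \<longleftrightarrow> (J + 3) * (2 * J + 3) < 2 ^ w"

lemma next_phase_fits_mono: "next_phase_fits w B \<Longrightarrow> J \<le> B \<Longrightarrow> next_phase_fits w J"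
  unfolding next_phase_fits_def by (erule le_less_trans[rotated]) (intro mult_le_mono, simp_all)

definition rebuilt :: "nat \<Rightarrow> nat \<Rightarrow> interval list \<Rightarrow> memory \<Rightarrow> bool" where
  "rebuilt w J xs m \<longleftrightarrow> block_store w J (2 * J) m \<and> ivar m ''updates'' = 0 \<and>
     contents (2 * J) J m = xs \<and> (\<forall>b<J. iarr m ''size'' b \<le> J) \<and> (\<forall>b<J. has_table (2 * J) m b)"

lemma redistribute_correct:
  assumes regs: "ivar m ''blocks'' = J" "ivar m ''capacity'' = 2 * J" "ivar m ''updates'' = 0"
    and sorted: "start_sorted (flat_list m)" and total: "ivar m ''total'' \<le> J * J"
    and fits: "(J + 2) * (2 * J + 1) < 2 ^ w"
  shows "exec_within w (distribute ;; build_tables) m (J * (J * 294 + 76) + 14)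
    (rebuilt w J (flat_list m))"
proof (rule exec_within_Seq)
  note [simp] = regs
  show "exec_within w distribute m (J * (J * 30 + 48) + 8)
      (\<lambda>m'. contents (2 * J) J m' = flat_list m \<and> (\<forall>b<J. iarr m' ''size'' b \<le> J))"
    using total fits by (intro distribute_correct) simp_all
  fix m1
  assume "agree_outside (modified distribute) m m1"
    and filled: "contents (2 * J) J m1 = flat_list m \<and> (\<forall>b<J. iarr m1 ''size'' b \<le> J)"
  note [simp] = agree_outsideD[OF this(1)]
  have store: "block_store w J (2 * J) m1" using filled fits by (fastforce simp: block_store_def)
  then have "exec_within w build_tables m1 (J * (132 * (2 * J) + 28) + 6)
      (\<lambda>m'. \<forall>b<J. has_table (2 * J) m' b)"
    using filled sorted by (intro build_tables_correct) simp_all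
  then show "exec_within w build_tables m1 (J * (264 * J + 28) + 6) (rebuilt w J (flat_list m))"
  proof (rule exec_within_weaken)
    fix m2
    assume "agree_outside (modified build_tables) m1 m2" and "\<forall>b<J. has_table (2 * J) m2 b"
    note [simp] = agree_outsideD[OF this(1)] this(2)
    have "contents (2 * J) J m2 = contents (2 * J) J m1"
      by (rule contents_cong) (simp add: block_def)
    then show "rebuilt w J (flat_list m) m2"
      using store filled by (simp add: rebuilt_def block_store_def)
  qed simp
qed (simp add: algebra_simps)

lemma rebuild_correct:
  assumes store: "block_store w J (2 * J) m" and sorted: "start_sorted (contents (2 * J) J m)"
    and len: "length (contents (2 * J) J m) \<le> (J + 1) * (J + 1)" and fits: "next_phase_fits w J"
  shows "exec_within w rebuild m (600 * ((J + 1) * (J + 1)))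
    (rebuilt w (J + 1) (contents (2 * J) J m))"
  unfolding rebuild_def
proof (rule exec_within_Seq[OF flatten_correct[OF store]], rule exec_within_Seq_wp)
  let ?J = "J + 1" and ?xs = "contents (2 * J) J m"
  have small: "J + 1 < 2 ^ w" "2 * J + 2 < 2 ^ w"
    using fits by (simp_all add: next_phase_fits_def algebra_simps)
  fix m1
  assume "agree_outside (modified flatten) m m1" and flat: "flat_list m1 = ?xs"
  note [simp] = agree_outsideD[OF this(1)] block_storeD(1)[OF store]
  let ?m = "m1\<lparr>ivar := (ivar m1)(''blocks'' := ?J, ''capacity'' := 2 * ?J, ''updates'' := 0)\<rparr>"
  have "flat_list ?m = ?xs" using flat by (simp add: flat_list_def)
  moreover have "ivar m1 ''total'' = length ?xs" by (simp flip: flat)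
  ultimately have "exec_within w (distribute ;; build_tables) ?m (?J * (?J * 294 + 76) + 14)
      (rebuilt w ?J ?xs)"
    using redistribute_correct[of ?m ?J w] sorted len fits
    by (simp add: next_phase_fits_def numeral_eq_Suc)
  then show "wp w (''blocks'' ::= \<acute>''blocks'' \<oplus> Num 1 ;; ''capacity'' ::= Num 2 \<otimes> \<acute>''blocks'' ;;
      ''updates'' ::= Num 0) (\<lambda>m2. exec_within w (distribute ;; build_tables) m2
        (?J * (?J * 294 + 76) + 14) (rebuilt w ?J ?xs)) m1"
    using small by simp
next
  show "J * (2 * J * 30 + 28) + 8 + ((J + 1) * ((J + 1) * 294 + 76) + 26) \<le>
      600 * ((J + 1) * (J + 1))"
    by (simp add: algebra_simps)
qed simp

section \<open>Updates\<close>

definition advance_phase :: com where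
  "advance_phase =
     ''updates'' ::= \<acute>''updates'' \<oplus> Num 1 ;;
     IF \<acute>''updates'' <\<^sub>i \<acute>''blocks'' THEN SKIP ELSE rebuild"

definition finish_update :: com where
  "finish_update = build_table ;; compute_answer ;; advance_phase"

definition interval_scheduler :: data_structure where
  "interval_scheduler = \<lparr>
     init_prog = ''blocks'' ::= Num 1 ;; ''capacity'' ::= Num 2,
     insert_prog = (find_block ;; insert_into_block) ;; finish_update,
     delete_prog = (find_block ;; delete_from_block) ;; finish_update\<rparr>"

text \<open>\<open>J\<close> blocks store \<open>S\<close> after \<open>K\<close> updates of phase \<open>J\<close>; the tables of the blocks in \<open>B\<close> may be
  outdated.\<close>

definition layout :: "nat \<Rightarrow> nat \<Rightarrow> nat \<Rightarrow> interval set \<Rightarrow> nat set \<Rightarrow> memory \<Rightarrow> bool" where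
  "layout w J K S B m \<longleftrightarrow> block_store w J (2 * J) m \<and>
     start_sorted (contents (2 * J) J m) \<and> set (contents (2 * J) J m) = S \<and>
     length (contents (2 * J) J m) \<le> J * J + K \<and> (\<forall>b<J. iarr m ''size'' b \<le> J + K) \<and>
     (\<forall>i\<in>S. is_interval i) \<and> (\<forall>b<J. b \<notin> B \<longrightarrow> has_table (2 * J) m b)"

definition ready :: "nat \<Rightarrow> nat \<Rightarrow> nat \<Rightarrow> interval set \<Rightarrow> memory \<Rightarrow> bool" where
  "ready w J K S m \<longleftrightarrow> K < J \<and> ivar m ''updates'' = K \<and> layout w J K S {} m"

lemma layoutD:
  assumes "layout w J K S B m"
  shows "block_store w J (2 * J) m" "start_sorted (contents (2 * J) J m)"
    "set (contents (2 * J) J m) = S" "\<forall>i\<in>S. is_interval i"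
    "length (contents (2 * J) J m) \<le> J * J + K"
    "b < J \<Longrightarrow> iarr m ''size'' b \<le> J + K" "b < J \<Longrightarrow> b \<notin> B \<Longrightarrow> has_table (2 * J) m b"
  using assms by (auto simp: layout_def)

lemma contents_update:
  assumes "b < n" "same_other_blocks W b m m'" "\<forall>b'<n. iarr m ''size'' b' \<le> W"
  shows "contents W n m' = contents W b m @ block W m' b @ concat (map (block W m) [Suc b..<n])"
proof -
  have same: "block W m' b' = block W m b'" if "b' < n" "b' \<noteq> b" for b'
    using assms that by (intro block_same_block) (auto simp: same_other_blocks_def)
  have "contents W b m' = contents W b m" using same assms(1) by (intro contents_cong) auto
  moreover have "map (block W m') [Suc b..<n] = map (block W m) [Suc b..<n]"
    using same by (intro map_cong) auto
  ultimately show ?thesis using contents_split[OF assms(1), of W m'] by metis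
qed

lemma layout_update:
  assumes layout: "layout w J K S {} m" and K: "K < J" and b: "b < J"
    and regs: "ivar m' ''blocks'' = ivar m ''blocks''" "ivar m' ''capacity'' = ivar m ''capacity''"
    and same: "same_other_blocks (2 * J) b m m'"
    and contents: "contents (2 * J) J m' = xs" "start_sorted xs" "\<forall>i\<in>set xs. is_interval i"
    and len: "length xs \<le> Suc (length (contents (2 * J) J m))"
      "iarr m' ''size'' b \<le> Suc (iarr m ''size'' b)"
  shows "layout w J (Suc K) (set xs) {b} m'"
proof -
  note store = layoutD(1)[OF layout] and length = layoutD(5)[OF layout]
    and old_sizes = layoutD(6)[OF layout] and tables = layoutD(7)[OF layout]
  have sizes: "iarr m' ''size'' b' \<le> J + Suc K" if "b' < J" for b'
  proof (cases "b' = b")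
    case False
    then show ?thesis using same old_sizes[OF that]
      by (simp add: same_other_blocks_def same_block_def)
  qed (use len(2) old_sizes[OF that] in simp)
  have "iarr m' ''size'' b' \<le> 2 * J" if "b' < J" for b' using sizes[OF that] K by simp
  then have "block_store w J (2 * J) m'" using store regs by (simp add: block_store_def)
  moreover have "has_table (2 * J) m' b'" if "b' < J" "b' \<noteq> b" for b'
    using tables[OF that(1)] has_table_same_block[of "2 * J" m m' b'] same that
      block_storeD(3)[OF store that(1)] by (simp add: same_other_blocks_def)
  ultimately show ?thesis using contents len(1) length sizes by (simp add: layout_def)
qed

lemma find_block_layout:
  assumes "layout w J K S B m" "0 < J"
  shows "exec_within w find_block m (J * 28 + 10) (\<lambda>m'. ivar m' ''b'' < J \<and>
    layout w J K S B m' \<and> block_of_start (2 * J) J (rvar m' ''start'') m' (ivar m' ''b''))"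
  using find_block_correct[OF layoutD(1,2)[OF assms(1)] assms(2)]
proof (rule exec_within_weaken)
  fix m'
  assume "agree_outside (modified find_block) m m'"
    and found: "ivar m' ''b'' < J \<and> block_of_start (2 * J) J (rvar m ''start'') m (ivar m' ''b'')"
  note [simp] = agree_outsideD[OF this(1)]
  have [simp]: "block W m' = block W m" for W by (simp add: block_def fun_eq_iff)
  then have [simp]: "contents W n m' = contents W n m" for W n by (simp add: contents_def)
  show "ivar m' ''b'' < J \<and> layout w J K S B m' \<and>
      block_of_start (2 * J) J (rvar m' ''start'') m' (ivar m' ''b'')"
    using found assms(1) by (simp add: layout_def block_store_def block_of_start_def has_table_def)
qed simp

subsection \<open>Insertion\<close>

lemma insort_key_append_left:
  "\<forall>y\<in>set xs. f y < f x \<Longrightarrow> insort_key f x (xs @ ys) = xs @ insort_key f x ys"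
  by (induction xs) auto

lemma insort_key_append_right:
  "\<forall>z\<in>set zs. f x \<le> f z \<Longrightarrow> insort_key f x (ys @ zs) = insort_key f x ys @ zs"
proof (induction ys)
  case Nil
  then show ?case by (cases zs) auto
qed auto

lemma start_sorted_insort_key:
  "start_sorted xs \<Longrightarrow> \<forall>j\<in>set xs. fst j \<noteq> fst i \<Longrightarrow> start_sorted (insort_key fst i xs)"
  by (induction xs) (auto simp: set_insort_key intro: order.strict_trans)

lemma contents_insert:
  assumes "b < J" "block_of_start W J (fst i) m b" "\<forall>b'<J. iarr m ''size'' b' \<le> W"
    and "block W m' b = insort_key fst i (block W m b)"
    and "same_other_blocks W b m m'"
  shows "contents W J m' = insort_key fst i (contents W J m)"
proof -
  let ?post = "concat (map (block W m) [Suc b..<J])"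
  have "contents W J m' = contents W b m @ insort_key fst i (block W m b) @ ?post"
    using contents_update[OF assms(1,5,3)] assms(4) by simp
  also have "\<dots> = insort_key fst i (contents W b m @ block W m b @ ?post)"
    using assms(2) by (subst insort_key_append_left, force simp: block_of_start_def)
      (subst insort_key_append_right, force simp: block_of_start_def, simp)
  finally show ?thesis using assms(1) by (simp add: contents_split)
qed

lemma insert_into_block_layout:
  assumes layout: "layout w J K S {} m" and K: "K < J" and valid: "valid_update S (Insert i)"
    and i: "passed_interval m = i"
    and b: "ivar m ''b'' = b" "b < J" "block_of_start (2 * J) J (fst i) m b"
  shows "exec_within w insert_into_block m (J * 100 + 30) (layout w J (Suc K) (insert i S) {b})"
proof (rule exec_within_weaken)
  note store = layoutD(1)[OF layout] and start_sorted = layoutD(2)[OF layout]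
    and elements = layoutD(3)[OF layout] and intervals = layoutD(4)[OF layout]
    and sizes = layoutD(6)[OF layout]
  have "iarr m ''size'' b < 2 * J" using sizes[OF b(2)] K by simp
  then show "exec_within w insert_into_block m (2 * J * 50 + 30)
      (\<lambda>m'. block (2 * J) m' b = insort_key fst i (block (2 * J) m b) \<and>
        same_other_blocks (2 * J) b m m')"
    using insert_into_block_correct[OF block_store_selected[OF store b(2,1)]
        start_sorted_block[OF start_sorted b(2)]] i by simp
  fix m'
  assume "agree_outside (modified insert_into_block) m m'"
    and inserted: "block (2 * J) m' b = insort_key fst i (block (2 * J) m b) \<and>
      same_other_blocks (2 * J) b m m'"
  note [simp] = agree_outsideD[OF this(1)]
  let ?xs = "insort_key fst i (contents (2 * J) J m)"
  have "\<forall>j\<in>S. fst j \<noteq> fst i" using valid by (fastforce simp: endpoints_def)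
  then have sorted: "start_sorted ?xs" using start_sorted_insort_key start_sorted elements by blast
  have contents: "contents (2 * J) J m' = ?xs"
    using b inserted block_storeD(3)[OF store] by (intro contents_insert[where b = b]) auto
  have "iarr m' ''size'' b = length (block (2 * J) m' b)" by simp
  then have size: "iarr m' ''size'' b = Suc (iarr m ''size'' b)" using inserted by simp
  have S: "set ?xs = insert i S" using elements by (simp add: set_insort_key)
  have "layout w J (Suc K) (set ?xs) {b} m'"
    using inserted contents sorted size S valid intervals
    by (intro layout_update[OF layout K b(2)]) auto
  then show "layout w J (Suc K) (insert i S) {b} m'" using S by simp
qed simp

lemma insert_layout:
  assumes layout: "layout w J K S {} m" and K: "K < J" and valid: "valid_update S (Insert i)"
    and i: "passed_interval m = i"
  shows "exec_within w (find_block ;; insert_into_block) m (J * 128 + 40)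
    (\<lambda>m'. ivar m' ''b'' < J \<and> layout w J (Suc K) (insert i S) {ivar m' ''b''} m')"
proof (rule exec_within_Seq[OF find_block_layout[OF layout]])
  fix m1
  assume agree: "agree_outside (modified find_block) m m1"
    and found: "ivar m1 ''b'' < J \<and> layout w J K S {} m1 \<and>
      block_of_start (2 * J) J (rvar m1 ''start'') m1 (ivar m1 ''b'')"
  have "passed_interval m1 = passed_interval m"
    by (simp add: passed_interval_def agree_outsideD[OF agree])
  then have i1: "passed_interval m1 = i" "rvar m1 ''start'' = fst i"
    using i by (auto simp: passed_interval_def)
  then have "exec_within w insert_into_block m1 (J * 100 + 30)
      (layout w J (Suc K) (insert i S) {ivar m1 ''b''})"
    using found by (intro insert_into_block_layout[OF _ K valid]) simp_all
  then show "exec_within w insert_into_block m1 (J * 100 + 30)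
      (\<lambda>m'. ivar m' ''b'' < J \<and> layout w J (Suc K) (insert i S) {ivar m' ''b''} m')"
    by (rule exec_within_weaken) (use found in \<open>simp_all add: agree_outsideD\<close>)
qed (use K in simp_all)

subsection \<open>Deletion\<close>

lemma contents_delete:
  assumes "b < J" "block_of_start W J x m b" "\<forall>b'<J. iarr m ''size'' b' \<le> W"
    and "block W m' b = filter (\<lambda>j. fst j \<noteq> x) (block W m b)"
    and "same_other_blocks W b m m'"
  shows "contents W J m' = filter (\<lambda>j. fst j \<noteq> x) (contents W J m)"
proof -
  let ?post = "concat (map (block W m) [Suc b..<J])" and ?P = "\<lambda>j :: interval. fst j \<noteq> x"
  have "filter ?P (contents W b m) = contents W b m" "filter ?P ?post = ?post"
    using assms(2) by (intro filter_True; force simp: block_of_start_def)+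
  then show ?thesis
    using contents_update[OF assms(1,5,3)] assms(4) contents_split[OF assms(1), of W m] by simp
qed

lemma start_sorted_inj:
  "start_sorted xs \<Longrightarrow> i \<in> set xs \<Longrightarrow> j \<in> set xs \<Longrightarrow> fst i = fst j \<Longrightarrow> i = j"
  by (induction xs) fastforce+

lemma delete_from_block_layout:
  assumes layout: "layout w J K S {} m" and K: "K < J" and i: "i \<in> S" "rvar m ''start'' = fst i"
    and b: "ivar m ''b'' = b" "b < J" "block_of_start (2 * J) J (fst i) m b"
  shows "exec_within w delete_from_block m (J * 100 + 30) (layout w J (Suc K) (S - {i}) {b})"
proof (rule exec_within_weaken)
  note store = layoutD(1)[OF layout] and start_sorted = layoutD(2)[OF layout]
    and elements = layoutD(3)[OF layout] and intervals = layoutD(4)[OF layout]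
  let ?P = "\<lambda>j. fst j \<noteq> fst i"
  show "exec_within w delete_from_block m (2 * J * 50 + 30)
      (\<lambda>m'. block (2 * J) m' b = filter ?P (block (2 * J) m b) \<and>
        same_other_blocks (2 * J) b m m')"
    using delete_from_block_correct[OF block_store_selected[OF store b(2,1)]] i by simp
  fix m'
  assume "agree_outside (modified delete_from_block) m m'"
    and deleted: "block (2 * J) m' b = filter ?P (block (2 * J) m b) \<and>
      same_other_blocks (2 * J) b m m'"
  note [simp] = agree_outsideD[OF this(1)]
  let ?xs = "filter ?P (contents (2 * J) J m)"
  have sorted: "start_sorted ?xs" using start_sorted by (rule sorted_wrt_filter)
  have contents: "contents (2 * J) J m' = ?xs"
    using b deleted block_storeD(3)[OF store] by (intro contents_delete[where b = b]) auto
  have "iarr m' ''size'' b = length (block (2 * J) m' b)" by simp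
  also have "\<dots> \<le> iarr m ''size'' b"
    using deleted length_filter_le[of ?P "block (2 * J) m b"] by simp
  finally have size: "iarr m' ''size'' b \<le> Suc (iarr m ''size'' b)" by simp
  have "j = i" if "j \<in> S" "fst j = fst i" for j
    using start_sorted_inj[OF start_sorted, of j i] elements i that by simp
  then have S: "set ?xs = S - {i}" using elements by auto
  have "layout w J (Suc K) (set ?xs) {b} m'"
    using deleted contents sorted size S intervals
    by (intro layout_update[OF layout K b(2)]) (auto intro: le_SucI)
  then show "layout w J (Suc K) (S - {i}) {b} m'" using S by simp
qed simp

lemma delete_layout:
  assumes layout: "layout w J K S {} m" and K: "K < J" and i: "i \<in> S" "rvar m ''start'' = fst i"
  shows "exec_within w (find_block ;; delete_from_block) m (J * 128 + 40)
    (\<lambda>m'. ivar m' ''b'' < J \<and> layout w J (Suc K) (S - {i}) {ivar m' ''b''} m')"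
proof (rule exec_within_Seq[OF find_block_layout[OF layout]])
  fix m1
  assume agree: "agree_outside (modified find_block) m m1"
    and found: "ivar m1 ''b'' < J \<and> layout w J K S {} m1 \<and>
      block_of_start (2 * J) J (rvar m1 ''start'') m1 (ivar m1 ''b'')"
  have "exec_within w delete_from_block m1 (J * 100 + 30)
      (layout w J (Suc K) (S - {i}) {ivar m1 ''b''})"
    using found i agree_outsideD[OF agree] by (intro delete_from_block_layout[OF _ K i(1)]) auto
  then show "exec_within w delete_from_block m1 (J * 100 + 30)
      (\<lambda>m'. ivar m' ''b'' < J \<and> layout w J (Suc K) (S - {i}) {ivar m' ''b''} m')"
    by (rule exec_within_weaken) (use found in \<open>simp_all add: agree_outsideD\<close>)
qed (use K in simp_all)

subsection \<open>Finishing an update\<close>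

lemma build_table_layout:
  assumes layout: "layout w J K S {ivar m ''b''} m" and b: "ivar m ''b'' < J"
  shows "exec_within w build_table m (J * 264 + 20) (layout w J K S {})"
proof (rule exec_within_weaken)
  note store = layoutD(1)[OF layout] and start_sorted = layoutD(2)[OF layout]
    and tables = layoutD(7)[OF layout]
  show "exec_within w build_table m (132 * (2 * J) + 20) (\<lambda>m'. has_table (2 * J) m' (ivar m ''b'') \<and>
      same_other_blocks (2 * J) (ivar m ''b'') m m')"
    using build_table_correct[OF block_store_selected[OF store b]]
      start_sorted_block[OF start_sorted b] by simp
  fix m'
  assume "agree_outside (modified build_table) m m'"
    and built: "has_table (2 * J) m' (ivar m ''b'') \<and>
      same_other_blocks (2 * J) (ivar m ''b'') m m'"
  note [simp] = agree_outsideD[OF this(1)]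
  have "contents (2 * J) J m' = contents (2 * J) J m" by (rule contents_cong) (simp add: block_def)
  moreover have "has_table (2 * J) m' b" if "b < J" for b
    using built tables[OF that] block_storeD(3)[OF store that]
      has_table_same_block[of "2 * J" m m' b]
    by (cases "b = ivar m ''b''") (auto simp: same_other_blocks_def)
  ultimately show "layout w J K S {} m'" using layout by (simp add: layout_def block_store_def)
qed simp

lemma compute_answer_layout:
  assumes layout: "layout w J K S {} m" and L: "2 * J < 2 ^ L"
  shows "exec_within w compute_answer m (J * (21 * L + 59) + 8)
    (\<lambda>m'. ivar m' ''answer'' = max_compatible S \<and> layout w J K S {} m')"
proof (rule exec_within_weaken[OF compute_answer_correct[where L = L]])
  note start_sorted = layoutD(2)[OF layout] and elements = layoutD(3)[OF layout]
    and intervals = layoutD(4)[OF layout]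
  show "block_store w J (2 * J) m" "start_sorted (contents (2 * J) J m)"
    "\<forall>b<J. has_table (2 * J) m b" using layoutD[OF layout] by simp_all
  fix m'
  assume "agree_outside (modified compute_answer) m m'"
    and answer: "ivar m' ''answer'' = fst (fold step (contents (2 * J) J m) (0, rvar m ''last''))"
  note [simp] = agree_outsideD[OF this(1)]
  have [simp]: "block W m' b = block W m b" for W b by (simp add: block_def)
  have "contents (2 * J) J m' = contents (2 * J) J m" by (rule contents_cong) simp
  then have "layout w J K S {} m'"
    using layout by (simp add: layout_def block_store_def has_table_def)
  then show "ivar m' ''answer'' = max_compatible S \<and> layout w J K S {} m'"
    using answer fold_step_max_compatible[OF start_sorted] elements intervals by simp
qed (use L in simp_all)

lemma modified_advance_phase [simp]: "modified advance_phase = modified rebuild"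
  by (auto simp: advance_phase_def)

lemma rebuild_ready:
  assumes layout: "layout w J J S {} m" and fits: "next_phase_fits w J"
  shows "exec_within w rebuild m (600 * ((J + 1) * (J + 1))) (ready w (Suc J) 0 S)"
proof (rule exec_within_weaken)
  show "exec_within w rebuild m (600 * ((J + 1) * (J + 1)))
      (rebuilt w (J + 1) (contents (2 * J) J m))"
    using layoutD(5)[OF layout] by (intro rebuild_correct[OF layoutD(1,2)[OF layout] _ fits]) simp
  show "ready w (Suc J) 0 S m'" if "rebuilt w (J + 1) (contents (2 * J) J m) m'" for m'
    using that layout by (simp add: rebuilt_def ready_def layout_def)
qed simp

definition ready_next :: "nat \<Rightarrow> nat \<Rightarrow> nat \<Rightarrow> interval set \<Rightarrow> memory \<Rightarrow> bool" where
  "ready_next w J K S = (if Suc K < J then ready w J (Suc K) S else ready w (Suc J) 0 S)"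

lemma advance_phase_correct:
  assumes layout: "layout w J (Suc K) S {} m" and K: "K < J" "ivar m ''updates'' = K"
    and fits: "next_phase_fits w J"
  shows "exec_within w advance_phase m
    (if Suc K < J then 9 else 600 * ((J + 1) * (J + 1)) + 8) (ready_next w J K S)"
  unfolding advance_phase_def
proof (rule exec_within_Seq_wp)
  let ?R = "if Suc K < J then 1 else 600 * ((J + 1) * (J + 1))"
  let ?m = "m\<lparr>ivar := (ivar m)(''updates'' := Suc K)\<rparr>"
  let ?Q = "ready_next w J K S"
  note [simp] = block_storeD(1)[OF layoutD(1)[OF layout]]
  have small: "J + 1 < 2 ^ w" using fits by (simp add: next_phase_fits_def algebra_simps)
  have layout': "layout w J (Suc K) S {} ?m"
    using layout contents_cong[of J "2 * J" ?m m] by (simp add: layout_def block_store_def)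
  have "exec_within w (IF \<acute>''updates'' <\<^sub>i \<acute>''blocks'' THEN SKIP ELSE rebuild) ?m (?R + 4) ?Q"
  proof (rule exec_within_Cond)
    assume "bval (\<acute>''updates'' <\<^sub>i \<acute>''blocks'') ?m"
    then have "Suc K < J" by simp
    then show "exec_within w SKIP ?m ?R ?Q" using layout'
      by (intro exec_within_wp) (simp_all add: ready_next_def ready_def)
  next
    assume "\<not> bval (\<acute>''updates'' <\<^sub>i \<acute>''blocks'') ?m"
    then have "J = Suc K" using K(1) by simp
    then show "exec_within w rebuild ?m ?R ?Q"
      using rebuild_ready[of w J S ?m] layout' fits by (simp add: ready_next_def)
  qed (use small K in simp_all)
  then show "wp w (''updates'' ::= \<acute>''updates'' \<oplus> Num 1) (\<lambda>m1. exec_within w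
      (IF \<acute>''updates'' <\<^sub>i \<acute>''blocks'' THEN SKIP ELSE rebuild) m1 (?R + 4) ?Q) m"
    using small K by simp
qed simp

lemma finish_update_correct:
  assumes layout: "layout w J (Suc K) S {ivar m ''b''} m" and b: "ivar m ''b'' < J"
    and K: "K < J" "ivar m ''updates'' = K" and fits: "next_phase_fits w J" and L: "2 * J < 2 ^ L"
  shows "exec_within w finish_update m
    (J * (21 * L + 323) + 37 + (if Suc K < J then 0 else 600 * ((J + 1) * (J + 1))))
    (\<lambda>m'. reported m' = max_compatible S \<and> ready_next w J K S m')"
  unfolding finish_update_def
proof (rule exec_within_Seq[where ?T2.0 = "J * (21 * L + 59) + 17 +
      (if Suc K < J then 0 else 600 * ((J + 1) * (J + 1)))", OF build_table_layout[OF layout b]],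
    rule exec_within_Seq[OF compute_answer_layout[OF _ L]])
  let ?T = "if Suc K < J then 9 else 600 * ((J + 1) * (J + 1)) + 8"
  fix m1
  assume "agree_outside (modified build_table) m m1" and layout1: "layout w J (Suc K) S {} m1"
  note [simp] = agree_outsideD[OF this(1)] K(2)
  show "layout w J (Suc K) S {} m1" by (rule layout1)
  fix m2
  assume "agree_outside (modified compute_answer) m1 m2"
    and answer: "ivar m2 ''answer'' = max_compatible S \<and> layout w J (Suc K) S {} m2"
  note [simp] = agree_outsideD[OF this(1)]
  have "exec_within w advance_phase m2 ?T (ready_next w J K S)"
    using answer K fits by (intro advance_phase_correct) simp_all
  then show "exec_within w advance_phase m2 ?T
      (\<lambda>m'. reported m' = max_compatible S \<and> ready_next w J K S m')"
    by (rule exec_within_weaken) (use answer in \<open>simp_all add: reported_def agree_outsideD\<close>)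
qed (simp_all add: algebra_simps)

section \<open>Amortized update time\<close>

lemma block_update_correct:
  assumes c: "exec_within w c m (J * 128 + 40)
      (\<lambda>m'. ivar m' ''b'' < J \<and> layout w J (Suc K) S {ivar m' ''b''} m')"
    and unmodified: "IReg ''updates'' \<notin> modified c" and K: "K < J" "ivar m ''updates'' = K"
    and fits: "next_phase_fits w J" and L: "2 * J < 2 ^ L"
  shows "exec_within w (c ;; finish_update) m
    (J * (21 * L + 530) + (if Suc K < J then 0 else 2400 * (J * J)))
    (\<lambda>m'. reported m' = max_compatible S \<and> ready_next w J K S m')"
proof (rule exec_within_Seq[OF c])
  fix m1
  assume "agree_outside (modified c) m m1"
    and "ivar m1 ''b'' < J \<and> layout w J (Suc K) S {ivar m1 ''b''} m1"
  then show "exec_within w finish_update m1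
      (J * (21 * L + 323) + 37 + (if Suc K < J then 0 else 600 * ((J + 1) * (J + 1))))
      (\<lambda>m'. reported m' = max_compatible S \<and> ready_next w J K S m')"
    using unmodified K fits L by (intro finish_update_correct) (simp_all add: agree_outsideD)
next
  have "(J + 1) * (J + 1) \<le> (2 * J) * (2 * J)" using K by (intro mult_le_mono) simp_all
  then show "J * 128 + 40 + (J * (21 * L + 323) + 37 +
      (if Suc K < J then 0 else 600 * ((J + 1) * (J + 1)))) \<le>
      J * (21 * L + 530) + (if Suc K < J then 0 else 2400 * (J * J))"
    using K by (simp add: algebra_simps)
qed

lemma ready_pass_interval: "ready w J K S m \<Longrightarrow> ready w J K S (pass_interval i m)"
proof -
  assume ready: "ready w J K S m"
  have block: "block W (pass_interval i m) = block W m" for W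
    by (simp add: block_def pass_interval_def fun_eq_iff)
  have "contents W n (pass_interval i m) = contents W n m" for W n by (simp add: contents_def block)
  with ready show ?thesis
    by (simp add: ready_def layout_def block_store_def has_table_def block)
      (simp add: pass_interval_def)
qed

lemma update_correct:
  assumes ready: "ready w J K S m" and valid: "valid_update S u"
    and fits: "next_phase_fits w J" and L: "2 * J < 2 ^ L"
  shows "\<exists>t m'. exec_update w interval_scheduler u m t m' \<and>
    t \<le> J * (21 * L + 530) + (if Suc K < J then 0 else 2400 * (J * J)) \<and>
    reported m' = max_compatible (apply_update u S) \<and> ready_next w J K (apply_update u S) m'"
proof (cases u)
  case (Insert i)
  have "ready w J K S (pass_interval i m)" using ready by (rule ready_pass_interval)
  then have "exec_within w ((find_block ;; insert_into_block) ;; finish_update) (pass_interval i m)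
      (J * (21 * L + 530) + (if Suc K < J then 0 else 2400 * (J * J)))
      (\<lambda>m'. reported m' = max_compatible (insert i S) \<and> ready_next w J K (insert i S) m')"
    using valid Insert fits L unfolding ready_def
    by (intro block_update_correct insert_layout)
      (simp_all add: pass_interval_def passed_interval_def)
  then show ?thesis by (auto simp: Insert exec_within_def interval_scheduler_def)
next
  case (Delete i)
  have "ready w J K S (pass_interval i m)" using ready by (rule ready_pass_interval)
  then have "exec_within w ((find_block ;; delete_from_block) ;; finish_update) (pass_interval i m)
      (J * (21 * L + 530) + (if Suc K < J then 0 else 2400 * (J * J)))
      (\<lambda>m'. reported m' = max_compatible (S - {i}) \<and> ready_next w J K (S - {i}) m')"
    using valid Delete fits L unfolding ready_def
    by (intro block_update_correct delete_layout) (simp_all add: pass_interval_def)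
  then show ?thesis by (auto simp: Delete exec_within_def interval_scheduler_def)
qed

text \<open>Rebuilding after phase \<open>J\<close> takes time \<open>2400 * (J * J)\<close>. Each of the \<open>J\<close> updates of the
  phase pays \<open>2400 * B\<close> for it in advance. Twice the number of all updates so far is
  \<open>J * (J - 1) + 2 * K\<close>.\<close>

lemma update_amortized:
  assumes ready: "ready w J K S m" and valid: "valid_update S u"
    and B: "J \<le> B" "next_phase_fits w B" "2 * B < 2 ^ L"
  obtains t m' J' K' where "exec_update w interval_scheduler u m t m'"
    "reported m' = max_compatible (apply_update u S)" "ready w J' K' (apply_update u S) m'"
    "J' * (J' - 1) + 2 * K' = J * (J - 1) + 2 * K + 2"
    "t + 2400 * B * K' \<le> B * (21 * L + 2930) + 2400 * B * K"
proof -
  have "next_phase_fits w J" using B(2,1) by (rule next_phase_fits_mono)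
  moreover have "2 * J < 2 ^ L" using B(1,3) by simp
  ultimately obtain t m' where exec: "exec_update w interval_scheduler u m t m'"
    and t: "t \<le> J * (21 * L + 530) + (if Suc K < J then 0 else 2400 * (J * J))"
    and reported: "reported m' = max_compatible (apply_update u S)"
    and next_ready: "ready_next w J K (apply_update u S) m'"
    using update_correct[OF ready valid] by blast
  have JB: "J * (21 * L + 530) \<le> B * (21 * L + 530)" using B(1) by (rule mult_le_mono1)
  show ?thesis
  proof (cases "Suc K < J")
    case True
    have "t + 2400 * B * Suc K \<le> B * (21 * L + 2930) + 2400 * B * K"
      using t JB True by (simp add: algebra_simps)
    then show ?thesis using that[of t m' J "Suc K"] exec reported next_ready True
      by (simp add: ready_next_def)
  next
    case False
    then have J: "J = Suc K" using ready by (simp add: ready_def)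
    have "J * J \<le> B * Suc K" using B(1) unfolding J by (rule mult_le_mono1)
    then have "t + 2400 * B * 0 \<le> B * (21 * L + 2930) + 2400 * B * K"
      using t JB False by (simp add: algebra_simps)
    then show ?thesis using that[of t m' "Suc J" 0] exec reported next_ready J
      by (simp add: ready_next_def)
  qed
qed

lemma updates_correct:
  assumes "ready w J K S m" "valid_updates S us" "J * (J - 1) + 2 * K + 2 * length us \<le> 2 * n"
    and B: "\<And>J. J * (J - 1) \<le> 2 * n \<Longrightarrow> J \<le> B" "next_phase_fits w B" "2 * B < 2 ^ L"
  shows "\<exists>t. exec_updates w interval_scheduler us m (correct_answers S us) t \<and>
    t \<le> length us * (B * (21 * L + 2930)) + 2400 * B * K"
  using assms(1-3)
proof (induction us arbitrary: J K S m)
  case Nil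
  then show ?case by (auto intro: exec_updates.Nil)
next
  case (Cons u us)
  have valid: "valid_update S u" "valid_updates (apply_update u S) us" using Cons.prems(2) by auto
  have "J \<le> B" using Cons.prems(3) by (intro B(1)) simp
  from update_amortized[OF Cons.prems(1) valid(1) this B(2,3)] obtain t1 m' J' K'
    where u: "exec_update w interval_scheduler u m t1 m'"
      "reported m' = max_compatible (apply_update u S)" "ready w J' K' (apply_update u S) m'"
    and phase: "J' * (J' - 1) + 2 * K' = J * (J - 1) + 2 * K + 2"
    and t1: "t1 + 2400 * B * K' \<le> B * (21 * L + 2930) + 2400 * B * K" .
  have "J' * (J' - 1) + 2 * K' + 2 * length us \<le> 2 * n" using phase Cons.prems(3) by simp
  from Cons.IH[OF u(3) valid(2) this] obtain t2
    where us: "exec_updates w interval_scheduler us m' (correct_answers (apply_update u S) us) t2"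
    and t2: "t2 \<le> length us * (B * (21 * L + 2930)) + 2400 * B * K'" by blast
  have "t1 + t2 \<le> length (u # us) * (B * (21 * L + 2930)) + 2400 * B * K" using t1 t2 by simp
  then show ?case using exec_updates.Cons[OF u(1) us] u(2) by auto
qed

lemma run_correct:
  assumes "valid_updates {} us"
    and B: "\<And>J. J * (J - 1) \<le> 2 * length us \<Longrightarrow> J \<le> B" "next_phase_fits w B" "2 * B < 2 ^ L"
  shows "\<exists>t. run w interval_scheduler us (correct_answers {} us) t \<and>
    t \<le> length us * (B * (21 * L + 2930)) + 4"
proof -
  let ?m = "empty_memory\<lparr>ivar := (ivar empty_memory)(''blocks'' := 1, ''capacity'' := 2)\<rparr>"
  have "1 \<le> B" by (rule B(1)) simp
  then have "next_phase_fits w 1" using B(2) next_phase_fits_mono by blast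
  then have w: "20 < (2 :: nat) ^ w" by (simp add: next_phase_fits_def)
  have "exec_within w (init_prog interval_scheduler) empty_memory 4 (\<lambda>m. m = ?m)"
    using w by (intro exec_within_wp) (simp_all add: interval_scheduler_def)
  then obtain t0 where t0: "exec w (init_prog interval_scheduler) empty_memory t0 ?m" "t0 \<le> 4"
    by (auto simp: exec_within_def)
  have "ready w 1 0 {} ?m"
    using w by (simp add: ready_def layout_def block_store_def contents_def block_def has_table_def
        skip_table_def overlapping_def empty_memory_def)
  from updates_correct[OF this assms(1), of "length us" B L] B
  obtain t1 where "exec_updates w interval_scheduler us ?m (correct_answers {} us) t1"
    "t1 \<le> length us * (B * (21 * L + 2930))" by auto
  then show ?thesis using t0 unfolding run_def by (intro exI[of _ "t0 + t1"]) auto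
qed

section \<open>Bounds in terms of the number of updates\<close>

definition max_phase :: "nat \<Rightarrow> nat" where
  "max_phase n = Suc (floor_sqrt (2 * n))"

definition search_depth :: "nat \<Rightarrow> nat" where
  "search_depth n = Suc (floor_log (2 * max_phase n))"

definition update_time :: "nat \<Rightarrow> real" where
  "update_time n = 10000 * sqrt (real n) * (ln (real n) + 1)"

lemma phase_le_max_phase:
  assumes "J * (J - 1) \<le> 2 * n"
  shows "J \<le> max_phase n"
proof -
  have "(J - 1)\<^sup>2 \<le> J * (J - 1)" unfolding power2_eq_square by (rule mult_le_mono1) simp
  then have "J - 1 \<le> floor_sqrt (2 * n)" using assms by (intro le_floor_sqrtI) simp
  then show ?thesis by (simp add: max_phase_def)
qed

lemma max_phase_less_power: "2 * max_phase n < 2 ^ search_depth n"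
  using floor_log_exp2_gt[of "2 * max_phase n"] by (simp add: search_depth_def)

lemma max_phase_le: "max_phase n \<le> 2 * n + 1"
  using floor_sqrt_le[of "2 * n"] by (simp add: max_phase_def)

lemma max_phase_le_sqrt:
  assumes "0 < n"
  shows "real (max_phase n) \<le> 3 * sqrt (real n)"
proof -
  have "(real (floor_sqrt (2 * n)))\<^sup>2 \<le> real (2 * n)"
    by (metis floor_sqrt_power2_le of_nat_le_iff of_nat_power)
  also have "\<dots> \<le> (2 * sqrt (real n))\<^sup>2" by (simp add: power_mult_distrib)
  finally have "real (floor_sqrt (2 * n)) \<le> 2 * sqrt (real n)" by (rule power2_le_imp_le) simp
  moreover have "1 \<le> sqrt (real n)" using assms by simp
  ultimately show ?thesis unfolding max_phase_def of_nat_Suc by linarith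
qed

lemma search_depth_le_ln:
  assumes "0 < n"
  shows "real (search_depth n) \<le> 4 + 2 * ln (real n)"
proof -
  have "2 ^ floor_log (2 * max_phase n) \<le> 2 * max_phase n"
    by (rule floor_log_exp2_le) (simp add: max_phase_def)
  also have "\<dots> \<le> 8 * n" using max_phase_le[of n] assms by simp
  finally have "real (floor_log (2 * max_phase n)) \<le> log 2 (real (8 * n))"
    by (rule le_log2_of_power)
  also have "\<dots> = log 2 (2 ^ 3) + log 2 (real n)" using assms by (simp add: log_mult)
  also have "\<dots> = 3 + ln (real n) / ln 2"
    using log_pow_cancel[of "2 :: real" 3] by (simp add: log_def[of 2 "real n"])
  also have "ln (real n) / ln 2 \<le> 2 * ln (real n)"
  proof -
    have "1 \<le> ln ((2 :: real) ^ 2)" using exp_le by (subst ln_ge_iff) auto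
    then have "1 \<le> 2 * ln (2 :: real)" by (subst (asm) ln_realpow) auto
    then have "ln (real n) * 1 \<le> ln (real n) * (2 * ln 2)"
      using assms by (intro mult_left_mono) auto
    then show ?thesis by (simp add: divide_le_eq mult_ac)
  qed
  finally show ?thesis by (simp add: search_depth_def)
qed

lemma max_phase_fits:
  assumes "0 < n" "6 * log 2 (real n + 1) \<le> real w"
  shows "next_phase_fits w (max_phase n)"
proof -
  let ?x = "n + 1"
  have "(max_phase n + 3) * (2 * max_phase n + 3) \<le> (2 * ?x + 2) * (4 * ?x + 1)"
    using max_phase_le[of n] by (intro mult_le_mono) simp_all
  also have "\<dots> < 2 ^ 4 * ?x ^ 2" using assms(1) by (simp add: power2_eq_square algebra_simps)
  also have "\<dots> \<le> ?x ^ 4 * ?x ^ 2" using assms(1) by (intro mult_le_mono1 power_mono) simp_all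
  also have "\<dots> = ?x ^ 6" by (simp flip: power_add)
  also have "\<dots> \<le> 2 ^ w"
  proof -
    have "log 2 (real ?x ^ 6) \<le> real w" using assms(2) by (simp add: log_nat_power add.commute)
    then have "real ?x ^ 6 \<le> 2 ^ w" by (subst (asm) log_le_iff) (simp_all add: powr_realpow)
    then show ?thesis by (metis of_nat_le_iff of_nat_numeral of_nat_power)
  qed
  finally show ?thesis by (simp add: next_phase_fits_def)
qed

lemma run_time_le_update_time:
  assumes "0 < n"
  shows "real (n * (max_phase n * (21 * search_depth n + 2930)) + 4) \<le> real n * update_time n"
proof -
  have ln: "0 \<le> ln (real n)" and sqrt: "1 \<le> sqrt (real n)" using assms by auto
  have "real (max_phase n * (21 * search_depth n + 2930)) =
      real (max_phase n) * (21 * real (search_depth n) + 2930)" by simp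
  also have "\<dots> \<le> (3 * sqrt (real n)) * (21 * (4 + 2 * ln (real n)) + 2930)"
    using max_phase_le_sqrt[OF assms] search_depth_le_ln[OF assms] by (intro mult_mono) auto
  also have "\<dots> = sqrt (real n) * (9042 + 126 * ln (real n))" by (simp add: algebra_simps)
  finally have "real (n * (max_phase n * (21 * search_depth n + 2930))) \<le>
      real n * (sqrt (real n) * (9042 + 126 * ln (real n)))"
    by (simp only: of_nat_mult) (rule mult_left_mono, simp_all)
  moreover have "1 * 1 \<le> real n * sqrt (real n)" using assms sqrt by (intro mult_mono) auto
  ultimately have "real (n * (max_phase n * (21 * search_depth n + 2930)) + 4) \<le>
      real n * (sqrt (real n) * (9046 + 126 * ln (real n)))" by (simp add: algebra_simps)
  also have "\<dots> \<le> real n * (sqrt (real n) * (10000 * (ln (real n) + 1)))"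
    using ln by (intro mult_left_mono) auto
  finally show ?thesis by (simp add: update_time_def mult_ac)
qed

lemma interval_scheduler_supports_updates:
  "supports_updates_amortized interval_scheduler update_time"
  unfolding supports_updates_amortized_def
proof (rule exI[of _ 6], intro allI impI)
  fix w us
  assume us: "us \<noteq> []" "valid_updates {} us" and w: "6 * log 2 (real (length us) + 1) \<le> real w"
  let ?n = "length us"
  have n: "0 < ?n" using us by simp
  obtain t where run: "run w interval_scheduler us (correct_answers {} us) t"
    and t: "t \<le> ?n * (max_phase ?n * (21 * search_depth ?n + 2930)) + 4"
    using run_correct[OF us(2) phase_le_max_phase max_phase_fits[OF n w] max_phase_less_power]
    by blast
  have "real t \<le> real ?n * update_time ?n"
    using t run_time_le_update_time[OF n] by (meson of_nat_le_iff order_trans)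
  then show "\<exists>t. run w interval_scheduler us (correct_answers {} us) t \<and>
      real t \<le> real ?n * update_time ?n" using run by blast
qed

lemma update_time_bigo: "update_time \<in> O(\<lambda>n. sqrt (real n) * ln (real n))"
proof (rule bigoI[of _ 20000])
  show "eventually (\<lambda>n. norm (update_time n) \<le> 20000 * norm (sqrt (real n) * ln (real n))) at_top"
    using eventually_ge_at_top[of 3]
  proof eventually_elim
    case (elim n)
    have "exp 1 \<le> real n" using exp_le elim by linarith
    then have ln: "1 \<le> ln (real n)" using elim by (simp add: ln_ge_iff)
    then have "sqrt (real n) * (ln (real n) + 1) \<le> sqrt (real n) * (2 * ln (real n))"
      by (intro mult_left_mono) auto
    then show ?case using ln by (simp add: update_time_def abs_mult)
  qed
qed

theorem theorem24:
  shows "\<exists>D \<tau>. supports_updates_amortized D \<tau> \<and>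
           \<tau> \<in> O(\<lambda>n. sqrt (real n) * ln (real n))"
  using interval_scheduler_supports_updates update_time_bigo by blast

end
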